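(* Let $K$ be an abstract simplicial complex on the vertex set $[m]=\{1,\dots,m\}$ and let $(\underline{U},\underline{V})=(\underline{B\vee C},\underline{B\vee E})$ be a wedge decomposable family of pointed CW pairs, i.e. $(U_i,V_i)=(B_i\vee C_i,\,B_i\vee E_i)$ for $i=1,\dots,m$, where each inclusion $E_i\hookrightarrow C_i$ is null homotopic. Then there is a homotopy equivalence $$\widehat{Z}\big(K;(\underline{U},\underline{V})\big)\longrightarrow \bigvee_{I\subseteq[m]}\Big(\widehat{Z}\big(K_I;(\underline{C},\underline{E})_I\big)\wedge \widehat{Z}\big(K_{[m]-I};(\underline{B},\underline{B})_{[m]-I}\big)\Big),$$ which is natural with respect to maps of wedge decomposable pairs. Here $\widehat{Z}\big(K_{[m]-I};(\underline{B},\underline{B})_{[m]-I}\big)=\bigwedge_{j\in[m]-I}B_j$, with the convention that $\widehat{Z}(K_\varnothing;(\underline{B},\underline{B})_\varnothing)$, $\widehat{Z}(K_\varnothing;(\underline{C},\underline{E})_\varnothing)$ and $\widehat{Z}(K_I;(\varnothing,\varnothing)_I)$ all equal $S^0$.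
   Context: Spaces are pointed and, as usual, compactly generated. A simplicial complex $K$ on $[m]$ is a collection of subsets of $[m]$ closed under taking subsets and containing $\varnothing$; elements of $[m]$ that are not vertices of $K$ (ghost vertices) are allowed. For $I\subseteq[m]$, $K_I=\{\sigma\in K:\sigma\subseteq I\}$ is the full subcomplex on $I$, regarded as a complex on the vertex set $I$. For a family $(\underline{X},\underline{A})=\{(X_i,A_i)\}_{i=1}^m$ of pointed CW pairs, $(\underline{X},\underline{A})_I=\{(X_i,A_i)\}_{i\in I}$. For $\sigma\in K$ set $\widehat{D}_{(\underline{X},\underline{A})}(\sigma)=\bigwedge_{i=1}^m W_i$ with $W_i=X_i$ if $i\in\sigma$ and $W_i=A_i$ if $i\notin\sigma$. The polyhedral smash product is $\widehat{Z}(K;(\underline{X},\underline{A}))=\bigcup_{\sigma\in K}\widehat{D}_{(\underline{X},\underline{A})}(\sigma)\subseteq X_1\wedge\cdots\wedge X_m$. For a complex on a vertex set $I\subseteq[m]$ the same definition is used with $i$ ranging over $I$. A map of wedge decomposable pairs from $(\underline{B\vee C},\underline{B\vee E})$ to $(\underline{B'\vee C'},\underline{B'\vee E'})$ is a family of maps induced by pointed maps $B_i\to B_i'$ and pointed maps of pairs $(C_i,E_i)\to(C_i',E_i')$. *)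

theory Defs
  imports "HOL-Analysis.Analysis"
begin

section \<open>Pointed spaces, pointed maps and pointed homotopies\<close>

record 'a pointed =
  ptop :: "'a topology"
  pbase :: 'a

abbreviation points :: "'a pointed \<Rightarrow> 'a set" where
  "points X \<equiv> topspace (ptop X)"

definition pointed_subspace :: "'a pointed \<Rightarrow> 'a set \<Rightarrow> 'a pointed" where
  "pointed_subspace X A = \<lparr>ptop = subtopology (ptop X) A, pbase = pbase X\<rparr>"

definition pointed_map :: "'a pointed \<Rightarrow> 'b pointed \<Rightarrow> ('a \<Rightarrow> 'b) \<Rightarrow> bool" where
  "pointed_map X Y f \<longleftrightarrow> continuous_map (ptop X) (ptop Y) f \<and> f (pbase X) = pbase Y"

definition pointed_homotopic ::
    "'a pointed \<Rightarrow> 'b pointed \<Rightarrow> ('a \<Rightarrow> 'b) \<Rightarrow> ('a \<Rightarrow> 'b) \<Rightarrow> bool" where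
  "pointed_homotopic X Y = homotopic_with (\<lambda>k. k (pbase X) = pbase Y) (ptop X) (ptop Y)"

definition pointed_homotopy_equivalence :: "'a pointed \<Rightarrow> 'b pointed \<Rightarrow> ('a \<Rightarrow> 'b) \<Rightarrow> bool" where
  "pointed_homotopy_equivalence X Y f \<longleftrightarrow>
     pointed_map X Y f \<and>
     (\<exists>g. pointed_map Y X g \<and>
          pointed_homotopic X X (g \<circ> f) id \<and> pointed_homotopic Y Y (f \<circ> g) id)"

definition null_homotopic_inclusion :: "'a pointed \<Rightarrow> 'a set \<Rightarrow> bool" where
  "null_homotopic_inclusion X A \<longleftrightarrow>
     pointed_homotopic (pointed_subspace X A) X id (\<lambda>_. pbase X)"


section \<open>CW pairs\<close>

definition disc :: "nat \<Rightarrow> (nat \<Rightarrow> real) topology" where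
  "disc n = subtopology (Euclidean_space n) {x. (\<Sum>i<n. (x i)\<^sup>2) \<le> 1}"

definition open_disc :: "nat \<Rightarrow> (nat \<Rightarrow> real) set" where
  "open_disc n = {x \<in> topspace (disc n). (\<Sum>i<n. (x i)\<^sup>2) < 1}"

definition disc_boundary :: "nat \<Rightarrow> (nat \<Rightarrow> real) set" where
  "disc_boundary n = {x \<in> topspace (disc n). (\<Sum>i<n. (x i)\<^sup>2) = 1}"

text \<open>
  \<open>\<E> n\<close> is the set of open \<open>n\<close>-cells. The conditions are, in order: Hausdorff, the open cells
  partition the space, characteristic maps together with closure-finiteness, weak topology.
\<close>

definition CW_structure :: "'a topology \<Rightarrow> (nat \<Rightarrow> 'a set set) \<Rightarrow> bool" where
  "CW_structure X \<E> \<longleftrightarrow>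
     Hausdorff_space X \<and>
     (\<Union>n. \<Union>(\<E> n)) = topspace X \<and>
     (\<forall>n n' e e'. e \<in> \<E> n \<and> e' \<in> \<E> n' \<and> (n, e) \<noteq> (n', e') \<longrightarrow> e \<inter> e' = {}) \<and>
     (\<forall>n. \<forall>e\<in>\<E> n. \<exists>\<phi>.
        continuous_map (disc n) X \<phi> \<and>
        homeomorphic_map (subtopology (disc n) (open_disc n)) (subtopology X e) \<phi> \<and>
        (\<exists>F. finite F \<and> F \<subseteq> (\<Union>k<n. \<E> k) \<and> \<phi> ` disc_boundary n \<subseteq> \<Union>F)) \<and>
     (\<forall>S. S \<subseteq> topspace X \<and> (\<forall>n. \<forall>e\<in>\<E> n. closedin X (S \<inter> X closure_of e)) \<longrightarrow> closedin X S)"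

definition CW_subcomplex :: "'a topology \<Rightarrow> (nat \<Rightarrow> 'a set set) \<Rightarrow> 'a set \<Rightarrow> bool" where
  "CW_subcomplex X \<E> A \<longleftrightarrow>
     (\<exists>\<F>. (\<forall>n. \<F> n \<subseteq> \<E> n) \<and> A = (\<Union>n. \<Union>(\<F> n)) \<and> (\<forall>n. \<forall>e\<in>\<F> n. X closure_of e \<subseteq> A))"

text \<open>The base point of a pointed CW pair \<open>(X, A)\<close> is a vertex of \<open>A\<close>.\<close>

definition pointed_CW_pair :: "'a pointed \<Rightarrow> 'a set \<Rightarrow> bool" where
  "pointed_CW_pair X A \<longleftrightarrow>
     (\<exists>\<E>. CW_structure (ptop X) \<E> \<and> CW_subcomplex (ptop X) \<E> A \<and>
          {pbase X} \<in> \<E> 0 \<and> pbase X \<in> A)"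

definition pointed_CW_complex :: "'a pointed \<Rightarrow> bool" where
  "pointed_CW_complex X \<longleftrightarrow> pointed_CW_pair X (points X)"


section \<open>Quotients\<close>

text \<open>
  The pointed space \<open>X/A\<close>: its points are the set \<open>A\<close>, which is the base point, and the singletons
  \<open>{x}\<close> with \<open>x \<notin> A\<close>. The base point is always present, so that \<open>X/\<emptyset>\<close> is \<open>X\<close> with a disjoint
  base point added; this makes the empty smash product equal to \<open>S\<^sup>0\<close>.
\<close>

definition collapse_map :: "'a set \<Rightarrow> 'a \<Rightarrow> 'a set" where
  "collapse_map A x = (if x \<in> A then A else {x})"

definition collapse :: "'a topology \<Rightarrow> 'a set \<Rightarrow> 'a set pointed" where
  "collapse X A =
     \<lparr>ptop = topology (\<lambda>U. U \<subseteq> insert A (collapse_map A ` topspace X) \<and>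
                         openin X {x \<in> topspace X. collapse_map A x \<in> U}),
      pbase = A\<rparr>"

lemma openin_collapse:
  "openin (ptop (collapse X A)) U \<longleftrightarrow>
     U \<subseteq> insert A (collapse_map A ` topspace X) \<and>
     openin X {x \<in> topspace X. collapse_map A x \<in> U}"
proof -
  let ?P = "\<lambda>U. U \<subseteq> insert A (collapse_map A ` topspace X) \<and>
                openin X {x \<in> topspace X. collapse_map A x \<in> U}"
  have "istopology ?P"
    unfolding istopology_def
  proof (intro conjI allI impI)
    fix S T assume S: "?P S" and T: "?P T"
    then show "S \<inter> T \<subseteq> insert A (collapse_map A ` topspace X)" by blast
    have "{x \<in> topspace X. collapse_map A x \<in> S \<inter> T} =
        {x \<in> topspace X. collapse_map A x \<in> S} \<inter> {x \<in> topspace X. collapse_map A x \<in> T}"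
      by blast
    with S T show "openin X {x \<in> topspace X. collapse_map A x \<in> S \<inter> T}"
      by (simp only: openin_Int)
  next
    fix \<K> assume \<K>: "\<forall>K\<in>\<K>. ?P K"
    then show "\<Union>\<K> \<subseteq> insert A (collapse_map A ` topspace X)" by blast
    have "{x \<in> topspace X. collapse_map A x \<in> \<Union>\<K>} =
        \<Union>((\<lambda>K. {x \<in> topspace X. collapse_map A x \<in> K}) ` \<K>)"
      by blast
    with \<K> show "openin X {x \<in> topspace X. collapse_map A x \<in> \<Union>\<K>}"
      by (metis (no_types, lifting) imageE openin_Union)
  qed
  then show ?thesis
    by (simp add: collapse_def topology_inverse')
qed

lemma points_collapse: "points (collapse X A) = insert A (collapse_map A ` topspace X)"
proof -
  let ?S = "insert A (collapse_map A ` topspace X)"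
  have "{x \<in> topspace X. collapse_map A x \<in> ?S} = topspace X" by blast
  then have "openin (ptop (collapse X A)) ?S" by (simp add: openin_collapse)
  then show ?thesis
    by (metis openin_collapse openin_subset openin_topspace subset_antisym)
qed

text \<open>The map \<open>X/A \<rightarrow> Y/A'\<close> induced by a map of pairs \<open>f : (X, A) \<rightarrow> (Y, A')\<close>.\<close>

definition collapse_induced :: "'a set \<Rightarrow> 'b set \<Rightarrow> ('a \<Rightarrow> 'b) \<Rightarrow> 'a set \<Rightarrow> 'b set" where
  "collapse_induced A A' f p = (if p = A then A' else collapse_map A' (f (the_elem p)))"


section \<open>Wedges\<close>

definition disjoint_sum :: "'a topology \<Rightarrow> 'b topology \<Rightarrow> ('a + 'b) topology" where
  "disjoint_sum X Y = topology (\<lambda>U. openin X (Inl -` U) \<and> openin Y (Inr -` U))"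

lemma openin_disjoint_sum:
  "openin (disjoint_sum X Y) U \<longleftrightarrow> openin X (Inl -` U) \<and> openin Y (Inr -` U)"
proof -
  have "istopology (\<lambda>U. openin X (Inl -` U) \<and> openin Y (Inr -` U))"
    unfolding istopology_def by (auto simp: vimage_Union)
  then show ?thesis
    by (simp add: disjoint_sum_def topology_inverse')
qed

definition wedge_base :: "'a pointed \<Rightarrow> 'b pointed \<Rightarrow> ('a + 'b) set" where
  "wedge_base X Y = {Inl (pbase X), Inr (pbase Y)}"

definition wedge :: "'a pointed \<Rightarrow> 'b pointed \<Rightarrow> ('a + 'b) set pointed" where
  "wedge X Y = collapse (disjoint_sum (ptop X) (ptop Y)) (wedge_base X Y)"

text \<open>For \<open>A \<subseteq> X\<close> and \<open>A' \<subseteq> Y\<close> containing the base points, \<open>A \<or> A'\<close> as a subset of \<open>X \<or> Y\<close>.\<close>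

definition wedge_subset ::
    "'a pointed \<Rightarrow> 'b pointed \<Rightarrow> 'a set \<Rightarrow> 'b set \<Rightarrow> ('a + 'b) set set" where
  "wedge_subset X Y A A' = collapse_map (wedge_base X Y) ` (Inl ` A \<union> Inr ` A')"

definition wedge_map ::
    "'a pointed \<Rightarrow> 'b pointed \<Rightarrow> 'c pointed \<Rightarrow> 'd pointed \<Rightarrow>
     ('a \<Rightarrow> 'c) \<Rightarrow> ('b \<Rightarrow> 'd) \<Rightarrow> ('a + 'b) set \<Rightarrow> ('c + 'd) set" where
  "wedge_map X Y X' Y' f g =
     collapse_induced (wedge_base X Y) (wedge_base X' Y') (map_sum f g)"

definition big_wedge_base :: "'i set \<Rightarrow> ('i \<Rightarrow> 'a pointed) \<Rightarrow> ('i \<times> 'a) set" where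
  "big_wedge_base J X = {(j, pbase (X j)) | j. j \<in> J}"

definition big_wedge :: "'i set \<Rightarrow> ('i \<Rightarrow> 'a pointed) \<Rightarrow> ('i \<times> 'a) set pointed" where
  "big_wedge J X = collapse (sum_topology (\<lambda>j. ptop (X j)) J) (big_wedge_base J X)"

definition big_wedge_map ::
    "'i set \<Rightarrow> ('i \<Rightarrow> 'a pointed) \<Rightarrow> ('i \<Rightarrow> 'b pointed) \<Rightarrow> ('i \<Rightarrow> 'a \<Rightarrow> 'b) \<Rightarrow>
     ('i \<times> 'a) set \<Rightarrow> ('i \<times> 'b) set" where
  "big_wedge_map J X Y f =
     collapse_induced (big_wedge_base J X) (big_wedge_base J Y) (\<lambda>(j, x). (j, f j x))"


section \<open>Smash products\<close>

text \<open>
  Smash products are formed in compactly generated spaces: the product topology is replaced by its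
  \<^const>\<open>kification\<close> before the fat wedge is collapsed.
\<close>

definition smash_base :: "'a pointed \<Rightarrow> 'b pointed \<Rightarrow> ('a \<times> 'b) set" where
  "smash_base X Y = {(x, y). x \<in> points X \<and> y \<in> points Y \<and> (x = pbase X \<or> y = pbase Y)}"

definition smash :: "'a pointed \<Rightarrow> 'b pointed \<Rightarrow> ('a \<times> 'b) set pointed" where
  "smash X Y = collapse (kification (prod_topology (ptop X) (ptop Y))) (smash_base X Y)"

definition smash_map ::
    "'a pointed \<Rightarrow> 'b pointed \<Rightarrow> 'c pointed \<Rightarrow> 'd pointed \<Rightarrow>
     ('a \<Rightarrow> 'c) \<Rightarrow> ('b \<Rightarrow> 'd) \<Rightarrow> ('a \<times> 'b) set \<Rightarrow> ('c \<times> 'd) set" where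
  "smash_map X Y X' Y' f g =
     collapse_induced (smash_base X Y) (smash_base X' Y') (map_prod f g)"

definition fat_wedge :: "'i set \<Rightarrow> ('i \<Rightarrow> 'a pointed) \<Rightarrow> ('i \<Rightarrow> 'a) set" where
  "fat_wedge I X = {x \<in> PiE I (\<lambda>i. points (X i)). \<exists>i\<in>I. x i = pbase (X i)}"

definition big_smash :: "'i set \<Rightarrow> ('i \<Rightarrow> 'a pointed) \<Rightarrow> ('i \<Rightarrow> 'a) set pointed" where
  "big_smash I X = collapse (kification (product_topology (\<lambda>i. ptop (X i)) I)) (fat_wedge I X)"

definition big_smash_map ::
    "'i set \<Rightarrow> ('i \<Rightarrow> 'a pointed) \<Rightarrow> ('i \<Rightarrow> 'b pointed) \<Rightarrow> ('i \<Rightarrow> 'a \<Rightarrow> 'b) \<Rightarrow>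
     ('i \<Rightarrow> 'a) set \<Rightarrow> ('i \<Rightarrow> 'b) set" where
  "big_smash_map I X Y f =
     collapse_induced (fat_wedge I X) (fat_wedge I Y) (\<lambda>x. \<lambda>i\<in>I. f i (x i))"


section \<open>Polyhedral smash products\<close>

definition simplicial_complex_on :: "nat set \<Rightarrow> nat set set \<Rightarrow> bool" where
  "simplicial_complex_on V K \<longleftrightarrow>
     {} \<in> K \<and> (\<forall>\<sigma>\<in>K. \<sigma> \<subseteq> V) \<and> (\<forall>\<sigma>\<in>K. \<forall>\<tau>. \<tau> \<subseteq> \<sigma> \<longrightarrow> \<tau> \<in> K)"

definition full_subcomplex :: "nat set set \<Rightarrow> nat set \<Rightarrow> nat set set" where
  "full_subcomplex K I = {\<sigma> \<in> K. \<sigma> \<subseteq> I}"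

text \<open>
  \<open>smash_block I X A \<sigma>\<close> is the smash product of the \<open>X i\<close> with \<open>i \<in> \<sigma>\<close> and the \<open>A i\<close> with
  \<open>i \<in> I - \<sigma>\<close>, as a subset of the smash product of all \<open>X i\<close>.
\<close>

definition smash_block ::
    "nat set \<Rightarrow> (nat \<Rightarrow> 'a pointed) \<Rightarrow> (nat \<Rightarrow> 'a set) \<Rightarrow> nat set \<Rightarrow> (nat \<Rightarrow> 'a) set set" where
  "smash_block I X A \<sigma> =
     insert (fat_wedge I X)
       (collapse_map (fat_wedge I X) ` PiE I (\<lambda>i. if i \<in> \<sigma> then points (X i) else A i))"

definition polyhedral_smash ::
    "nat set \<Rightarrow> nat set set \<Rightarrow> (nat \<Rightarrow> 'a pointed) \<Rightarrow> (nat \<Rightarrow> 'a set) \<Rightarrow>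
     (nat \<Rightarrow> 'a) set pointed" where
  "polyhedral_smash I K X A =
     \<lparr>ptop = kification (subtopology (ptop (big_smash I X)) (\<Union>\<sigma>\<in>K. smash_block I X A \<sigma>)),
      pbase = pbase (big_smash I X)\<rparr>"

lemma polyhedral_smash_empty_index:
  assumes "simplicial_complex_on V K"
  shows "polyhedral_smash {} (full_subcomplex K {}) X A =
           \<lparr>ptop = discrete_topology {{}, {\<lambda>_. undefined}}, pbase = {}\<rparr>"
proof -
  have K: "full_subcomplex K {} = {{}}"
    using assms by (auto simp: full_subcomplex_def simplicial_complex_on_def)
  have fat: "fat_wedge {} X = {}"
    by (simp add: fat_wedge_def)
  have block: "smash_block {} X A {} = {{}, {\<lambda>_. undefined}}"
    by (simp add: smash_block_def fat collapse_map_def)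
  have kif: "kification (discrete_topology S) = discrete_topology S" for S :: "'x set"
    by (metis discrete_topology_unique openin_discrete_topology openin_kification_finer
        topspace_discrete_topology topspace_kification)
  have open1: "openin (kification (product_topology (\<lambda>i. ptop (X i)) {})) T \<longleftrightarrow>
      T \<subseteq> {\<lambda>_. undefined}" for T
    by (simp add: product_topology_empty_discrete kif)
  have "ptop (big_smash {} X) = discrete_topology {{}, {\<lambda>_. undefined}}"
    by (rule topology_eq[THEN iffD2])
      (auto simp: big_smash_def openin_collapse fat open1 collapse_map_def)
  then show ?thesis
    by (simp add: polyhedral_smash_def K block kif)
      (simp add: big_smash_def collapse_def fat)
qed


section \<open>Wedge decomposable pairs\<close>

text \<open>
  A wedge decomposable family \<open>(B \<or> C, B \<or> E)\<close> is given by the families \<open>B\<close>, \<open>C\<close> and \<open>E\<close>, of which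
  only the members with index in \<open>{1..m}\<close> matter.
\<close>

definition wedge_decomposable ::
    "nat \<Rightarrow> (nat \<Rightarrow> 'b pointed) \<Rightarrow> (nat \<Rightarrow> 'c pointed) \<Rightarrow> (nat \<Rightarrow> 'c set) \<Rightarrow> bool" where
  "wedge_decomposable m B C E \<longleftrightarrow>
     (\<forall>i\<in>{1..m}. pointed_CW_complex (B i) \<and> pointed_CW_pair (C i) (E i) \<and>
                 null_homotopic_inclusion (C i) (E i))"

definition wedge_decomposable_map ::
    "nat \<Rightarrow> (nat \<Rightarrow> 'b pointed) \<Rightarrow> (nat \<Rightarrow> 'c pointed) \<Rightarrow> (nat \<Rightarrow> 'c set) \<Rightarrow>
     (nat \<Rightarrow> 'b2 pointed) \<Rightarrow> (nat \<Rightarrow> 'c2 pointed) \<Rightarrow> (nat \<Rightarrow> 'c2 set) \<Rightarrow>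
     (nat \<Rightarrow> 'b \<Rightarrow> 'b2) \<Rightarrow> (nat \<Rightarrow> 'c \<Rightarrow> 'c2) \<Rightarrow> bool" where
  "wedge_decomposable_map m B C E B' C' E' f g \<longleftrightarrow>
     (\<forall>i\<in>{1..m}. pointed_map (B i) (B' i) (f i) \<and> pointed_map (C i) (C' i) (g i) \<and>
                 g i ` E i \<subseteq> E' i)"

definition decomp_source ::
    "nat \<Rightarrow> nat set set \<Rightarrow> (nat \<Rightarrow> 'b pointed) \<Rightarrow> (nat \<Rightarrow> 'c pointed) \<Rightarrow> (nat \<Rightarrow> 'c set) \<Rightarrow>
     (nat \<Rightarrow> ('b + 'c) set) set pointed" where
  "decomp_source m K B C E =
     polyhedral_smash {1..m} K (\<lambda>i. wedge (B i) (C i))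
       (\<lambda>i. wedge_subset (B i) (C i) (points (B i)) (E i))"

definition decomp_summand ::
    "nat \<Rightarrow> nat set set \<Rightarrow> (nat \<Rightarrow> 'b pointed) \<Rightarrow> (nat \<Rightarrow> 'c pointed) \<Rightarrow> (nat \<Rightarrow> 'c set) \<Rightarrow>
     nat set \<Rightarrow> ((nat \<Rightarrow> 'c) set \<times> (nat \<Rightarrow> 'b) set) set pointed" where
  "decomp_summand m K B C E I =
     smash (polyhedral_smash I (full_subcomplex K I) C E)
           (polyhedral_smash ({1..m} - I) (full_subcomplex K ({1..m} - I)) B (\<lambda>j. points (B j)))"

definition decomp_target ::
    "nat \<Rightarrow> nat set set \<Rightarrow> (nat \<Rightarrow> 'b pointed) \<Rightarrow> (nat \<Rightarrow> 'c pointed) \<Rightarrow> (nat \<Rightarrow> 'c set) \<Rightarrow>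
     (nat set \<times> ((nat \<Rightarrow> 'c) set \<times> (nat \<Rightarrow> 'b) set) set) set pointed" where
  "decomp_target m K B C E = big_wedge (Pow {1..m}) (decomp_summand m K B C E)"

text \<open>
  The maps of sources and targets induced by \<open>f : B \<rightarrow> B'\<close> and \<open>g : (C, E) \<rightarrow> (C', E')\<close>. A map of
  polyhedral smash products is the restriction of the induced map of full smash products, so that
  the same function serves for both.
\<close>

definition decomp_source_map ::
    "nat \<Rightarrow> (nat \<Rightarrow> 'b pointed) \<Rightarrow> (nat \<Rightarrow> 'c pointed) \<Rightarrow>
     (nat \<Rightarrow> 'b2 pointed) \<Rightarrow> (nat \<Rightarrow> 'c2 pointed) \<Rightarrow>
     (nat \<Rightarrow> 'b \<Rightarrow> 'b2) \<Rightarrow> (nat \<Rightarrow> 'c \<Rightarrow> 'c2) \<Rightarrow>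
     (nat \<Rightarrow> ('b + 'c) set) set \<Rightarrow> (nat \<Rightarrow> ('b2 + 'c2) set) set" where
  "decomp_source_map m B C B' C' f g =
     big_smash_map {1..m} (\<lambda>i. wedge (B i) (C i)) (\<lambda>i. wedge (B' i) (C' i))
       (\<lambda>i. wedge_map (B i) (C i) (B' i) (C' i) (f i) (g i))"

definition decomp_target_map ::
    "nat \<Rightarrow> nat set set \<Rightarrow>
     (nat \<Rightarrow> 'b pointed) \<Rightarrow> (nat \<Rightarrow> 'c pointed) \<Rightarrow> (nat \<Rightarrow> 'c set) \<Rightarrow>
     (nat \<Rightarrow> 'b2 pointed) \<Rightarrow> (nat \<Rightarrow> 'c2 pointed) \<Rightarrow> (nat \<Rightarrow> 'c2 set) \<Rightarrow>
     (nat \<Rightarrow> 'b \<Rightarrow> 'b2) \<Rightarrow> (nat \<Rightarrow> 'c \<Rightarrow> 'c2) \<Rightarrow>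
     (nat set \<times> ((nat \<Rightarrow> 'c) set \<times> (nat \<Rightarrow> 'b) set) set) set \<Rightarrow>
     (nat set \<times> ((nat \<Rightarrow> 'c2) set \<times> (nat \<Rightarrow> 'b2) set) set) set" where
  "decomp_target_map m K B C E B' C' E' f g =
     big_wedge_map (Pow {1..m}) (decomp_summand m K B C E) (decomp_summand m K B' C' E')
       (\<lambda>I. smash_map
          (polyhedral_smash I (full_subcomplex K I) C E)
          (polyhedral_smash ({1..m} - I) (full_subcomplex K ({1..m} - I)) B (\<lambda>j. points (B j)))
          (polyhedral_smash I (full_subcomplex K I) C' E')
          (polyhedral_smash ({1..m} - I) (full_subcomplex K ({1..m} - I)) B' (\<lambda>j. points (B' j)))
          (big_smash_map I C C' g)
          (big_smash_map ({1..m} - I) B B' f))"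

text \<open>
  A transformation assigns to every \<open>(B, C, E)\<close> a function from source to target. In
  \<open>decomp_natural\<close> the transformations \<open>h\<close> and \<open>h'\<close> may live over different point types, so that
  naturality covers maps between families with different point types. The squares commute strictly,
  not just up to homotopy.
\<close>

type_synonym ('b, 'c) decomp_transformation =
  "(nat \<Rightarrow> 'b pointed) \<Rightarrow> (nat \<Rightarrow> 'c pointed) \<Rightarrow> (nat \<Rightarrow> 'c set) \<Rightarrow>
   (nat \<Rightarrow> ('b + 'c) set) set \<Rightarrow> (nat set \<times> ((nat \<Rightarrow> 'c) set \<times> (nat \<Rightarrow> 'b) set) set) set"

definition decomp_equivalence ::
    "nat \<Rightarrow> nat set set \<Rightarrow> ('b, 'c) decomp_transformation \<Rightarrow> bool" where
  "decomp_equivalence m K h \<longleftrightarrow>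
     (\<forall>B C E. wedge_decomposable m B C E \<longrightarrow>
        pointed_homotopy_equivalence (decomp_source m K B C E) (decomp_target m K B C E) (h B C E))"

definition decomp_natural ::
    "nat \<Rightarrow> nat set set \<Rightarrow> ('b, 'c) decomp_transformation \<Rightarrow>
     ('b2, 'c2) decomp_transformation \<Rightarrow> bool" where
  "decomp_natural m K h h' \<longleftrightarrow>
     (\<forall>B C E B' C' E' f g.
        wedge_decomposable m B C E \<and> wedge_decomposable m B' C' E' \<and>
        wedge_decomposable_map m B C E B' C' E' f g \<longrightarrow>
        (\<forall>p \<in> points (decomp_source m K B C E).
           h' B' C' E' (decomp_source_map m B C B' C' f g p) =
           decomp_target_map m K B C E B' C' E' f g (h B C E p)))"

end

theory Submission
  imports Defs
begin

text \<open>
  A point of the smash product of the \<open>B\<^sub>i \<or> C\<^sub>i\<close> other than the base point has each coordinate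
  either in \<open>B\<^sub>i\<close> or in \<open>C\<^sub>i\<close>. Sorting points by the set \<open>I\<close> of indices of the second kind splits
  the polyhedral smash product into the summands of the wedge, and the resulting natural bijection
  is a homeomorphism. It is continuous because finitely many closed sets, one for each \<open>I\<close>, cover
  the source, and the bijection is a pinch map on each of them. Its inverse is continuous because in
  the compactly generated setting the product of a collapse with a Hausdorff space is again
  a quotient; this follows from Whitehead's theorem for locally compact factors by restricting to
  compact subsets of the Hausdorff factor.
\<close>

section \<open>Collapsing a subset\<close>

text \<open>Why \<open>K_I\<close> appears: a coordinate with index outside \<open>I\<close> lies in
  \<open>B\<^sub>j\<close>, which is contained in both members of the pair, so a block of \<sigma>
  imposes no condition there. A coordinate with index in \<open>I\<close> lies in
  \<open>C\<^sub>i\<close>, and in \<open>E\<^sub>i\<close> if the index is not in \<sigma>. Summand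
  \<open>I\<close> therefore sees the block of \<sigma> as the block of
  \<open>\<sigma> \<inter> I\<close>. The inverse is the harder direction: a summand collapses a
  product of two collapses, and a product of quotient maps need not be a quotient map. The two
  collapses are treated one at a time, and the factor left alone must be Hausdorff each time; the CW
  hypotheses provide this, together with closed subcomplexes and closed base points. If
  \<open>I\<close> is empty or all of \<open>{1..m}\<close>, one factor has an empty fat wedge. Its
  \<open>collapse_map\<close> then misses the base point and is not surjective, so criteria for maps
  out of a collapse carry a separate condition at the base point.\<close>

lemma closedin_collapse:
  "closedin (ptop (collapse X A)) S \<longleftrightarrow>
     S \<subseteq> points (collapse X A) \<and> closedin X {x \<in> topspace X. collapse_map A x \<in> S}"
proof -
  have "{x \<in> topspace X. collapse_map A x \<in> points (collapse X A) - S} =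
      topspace X - {x \<in> topspace X. collapse_map A x \<in> S}"
    by (auto simp: points_collapse)
  then show ?thesis
    unfolding closedin_def openin_collapse by (auto simp: points_collapse)
qed

lemma continuous_map_collapse_map: "continuous_map X (ptop (collapse X A)) (collapse_map A)"
  unfolding continuous_map_def openin_collapse points_collapse by blast

text \<open>The point \<open>A\<close> has its own condition because \<open>collapse_map A\<close>
  misses it when \<open>A\<close> does not meet \<open>X\<close>. It is then an isolated point, so
  it is enough that its value lies in \<open>Y\<close>.\<close>

lemma continuous_map_from_collapse:
  assumes "f A \<in> topspace Y" "continuous_map X Y (\<lambda>x. f (collapse_map A x))"
  shows "continuous_map (ptop (collapse X A)) Y f"
  unfolding continuous_map_def openin_collapse
proof (intro conjI allI impI)
  show "f \<in> points (collapse X A) \<rightarrow> topspace Y"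
    using assms continuous_map_image_subset_topspace[OF assms(2)] by (auto simp: points_collapse)
  fix U assume "openin Y U"
  then have "openin X {x \<in> topspace X. f (collapse_map A x) \<in> U}"
    using assms(2) by (simp add: continuous_map_def)
  moreover have "{x \<in> topspace X. f (collapse_map A x) \<in> U} =
      {x \<in> topspace X. collapse_map A x \<in> {p \<in> points (collapse X A). f p \<in> U}}"
    by (auto simp: points_collapse)
  ultimately show "openin X {x \<in> topspace X. collapse_map A x \<in> {p \<in> points (collapse X A). f p \<in> U}}"
    by simp
  show "{p \<in> points (collapse X A). f p \<in> U} \<subseteq> insert A (collapse_map A ` topspace X)"
    by (auto simp: points_collapse)
qed

lemma pbase_collapse [simp]: "pbase (collapse X A) = A"
  by (simp add: collapse_def)

text \<open>The value \<open>y\<close> at the base point is a parameter because \<open>A\<close> has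
  no distinguished element and may be empty. Every other point is a singleton, so
  \<open>the_elem\<close> recovers its representative.\<close>

definition collapse_lift :: "'a set \<Rightarrow> 'b \<Rightarrow> ('a \<Rightarrow> 'b) \<Rightarrow> 'a set \<Rightarrow> 'b" where
  "collapse_lift A y f p = (if p = A then y else f (the_elem p))"

lemma collapse_lift_base [simp]: "collapse_lift A y f A = y"
  by (simp add: collapse_lift_def)

lemma collapse_lift_collapse_map:
  "collapse_lift A y f (collapse_map A x) = (if x \<in> A then y else f x)"
  by (auto simp: collapse_lift_def collapse_map_def)

lemma collapse_lift_const: "collapse_lift A y (\<lambda>_. y) p = y"
  by (simp add: collapse_lift_def)

lemma collapse_induced_eq_lift: "collapse_induced A A' f = collapse_lift A A' (\<lambda>x. collapse_map A' (f x))"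
  by (simp add: fun_eq_iff collapse_induced_def collapse_lift_def)

lemma continuous_map_collapse_lift:
  assumes "continuous_map X Y f" "y \<in> topspace Y" "\<And>x. x \<in> A \<Longrightarrow> x \<in> topspace X \<Longrightarrow> f x = y"
  shows "continuous_map (ptop (collapse X A)) Y (collapse_lift A y f)"
proof (rule continuous_map_from_collapse)
  show "continuous_map X Y (\<lambda>x. collapse_lift A y f (collapse_map A x))"
    by (rule continuous_map_eq[OF assms(1)]) (simp add: assms(3) collapse_lift_collapse_map)
qed (simp add: assms)

text \<open>The identity from \<open>X/A\<close> to its kification is continuous, since its
  composite with \<open>collapse_map A\<close> is a continuous map out of a k-space; so the two
  topologies coincide. The argument does not need \<open>collapse_map A\<close> to be surjective and
  thus covers an empty \<open>A\<close>.\<close>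

lemma k_space_collapse:
  assumes "k_space X"
  shows "k_space (ptop (collapse X A))"
proof -
  let ?Y = "ptop (collapse X A)"
  have "continuous_map ?Y (kification ?Y) (\<lambda>p. p)"
    by (rule continuous_map_from_collapse)
      (use continuous_map_collapse_map[of X A] in
        \<open>auto simp: points_collapse continuous_map_into_kification[OF assms]\<close>)
  then have "openin ?Y U" if "openin (kification ?Y) U" for U
    using openin_continuous_map_preimage[OF _ that, of ?Y "\<lambda>p. p"] openin_subset[OF that]
    by (simp add: Collect_conj_eq Int_absorb1)
  then have "openin (kification ?Y) U \<longleftrightarrow> openin ?Y U" for U
    using openin_kification_finer by blast
  then have "kification ?Y = ?Y"
    by (simp add: topology_eq)
  then show ?thesis
    by (simp add: kification_eq_self)
qed

text \<open>The second hypothesis makes \<open>U\<close> saturated. The second conclusion adds the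
  base point by hand, which matters when \<open>A\<close> is empty and the image of \<open>U\<close>
  does not contain it.\<close>

lemma openin_collapse_image:
  assumes "openin X U" "A \<subseteq> U \<or> U \<inter> A = {}"
  shows "openin (ptop (collapse X A)) (collapse_map A ` U)"
    and "A \<subseteq> U \<Longrightarrow> openin (ptop (collapse X A)) (insert A (collapse_map A ` U))"
proof -
  have sub: "U \<subseteq> topspace X"
    using assms(1) by (rule openin_subset)
  have 1: "{x \<in> topspace X. collapse_map A x \<in> collapse_map A ` U} = U"
    using assms(2) sub by (auto simp: collapse_map_def split: if_splits)
  show "openin (ptop (collapse X A)) (collapse_map A ` U)"
    unfolding openin_collapse 1 using assms(1) sub by auto
  have 2: "{x \<in> topspace X. collapse_map A x \<in> insert A (collapse_map A ` U)} = U" if "A \<subseteq> U"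
    using that sub by (auto simp: collapse_map_def split: if_splits)
  show "openin (ptop (collapse X A)) (insert A (collapse_map A ` U))" if "A \<subseteq> U"
    unfolding openin_collapse 2[OF that] using assms(1) sub by auto
qed

lemma quotient_map_collapse_map:
  assumes "A \<inter> topspace X \<noteq> {}"
  shows "quotient_map X (ptop (collapse X A)) (collapse_map A)"
proof -
  have "A \<in> collapse_map A ` topspace X"
    using assms by (auto simp: collapse_map_def image_iff)
  then have "points (collapse X A) = collapse_map A ` topspace X"
    by (auto simp: points_collapse)
  then show ?thesis
    unfolding quotient_map_def openin_collapse by (auto simp: points_collapse)
qed

text \<open>If \<open>A\<close> misses \<open>X\<close>, then \<open>X/A\<close> is \<open>X\<close>
  with an isolated point added, and \<open>the_elem\<close> inverts \<open>collapse_map A\<close>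
  away from that point.\<close>

lemma continuous_map_the_elem_collapse:
  assumes "A \<inter> topspace X = {}"
  shows "continuous_map (subtopology (ptop (collapse X A)) (points (collapse X A) - {A})) X the_elem"
proof -
  have pts: "points (collapse X A) - {A} = (\<lambda>x. {x}) ` topspace X"
    using assms by (auto simp: points_collapse collapse_map_def)
  have single: "openin (ptop (collapse X A)) ((\<lambda>x. {x}) ` U)" if "openin X U" for U
  proof -
    have "U \<inter> A = {}"
      using assms openin_subset[OF that] by blast
    moreover from this have "collapse_map A ` U = (\<lambda>x. {x}) ` U"
      by (intro image_cong) (auto simp: collapse_map_def)
    ultimately show ?thesis
      using openin_collapse_image(1)[OF that, of A] by simp
  qed
  show ?thesis
    unfolding continuous_map_def
  proof (intro conjI allI impI)
    have top: "topspace (subtopology (ptop (collapse X A)) (points (collapse X A) - {A})) = (\<lambda>x. {x}) ` topspace X"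
      unfolding topspace_subtopology pts[symmetric] by blast
    show "the_elem \<in> topspace (subtopology (ptop (collapse X A)) (points (collapse X A) - {A})) \<rightarrow> topspace X"
      unfolding top by auto
    fix U assume U: "openin X U"
    have "{p \<in> topspace (subtopology (ptop (collapse X A)) (points (collapse X A) - {A})). the_elem p \<in> U}
        = (\<lambda>x. {x}) ` U"
      unfolding top using openin_subset[OF U] by auto
    moreover have "(\<lambda>x. {x}) ` U \<subseteq> points (collapse X A) - {A}"
      unfolding pts using openin_subset[OF U] by blast
    ultimately show "openin (subtopology (ptop (collapse X A)) (points (collapse X A) - {A}))
        {p \<in> topspace (subtopology (ptop (collapse X A)) (points (collapse X A) - {A})). the_elem p \<in> U}"
      using single[OF U] by (auto simp: openin_subtopology)
  qed
qed

section \<open>Products of a collapse with a Hausdorff space\<close>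

text \<open>Whitehead's theorem as a criterion for maps out of the product. If \<open>A\<close>
  meets \<open>X\<close>, the collapse times the identity of \<open>Z\<close> is a quotient map, as
  \<open>Z\<close> is locally compact Hausdorff. If not, the slice over the base point is outside
  its image, and \<open>base\<close> controls it.\<close>

lemma continuous_map_prod_collapse:
  assumes loc: "locally_compact_space Z" "Hausdorff_space Z"
    and base: "continuous_map Z W (\<lambda>z. f (A, z))"
    and f: "continuous_map (prod_topology X Z) W (\<lambda>(x, z). f (collapse_map A x, z))"
  shows "continuous_map (prod_topology (ptop (collapse X A)) Z) W f"
proof (cases "A \<inter> topspace X = {}")
  case False
  have q: "quotient_map (prod_topology X Z) (prod_topology (ptop (collapse X A)) Z)
      (\<lambda>(x, z). (collapse_map A x, z))"
    using quotient_map_prod_left[OF loc(1) _ quotient_map_collapse_map[OF False]] loc(2) by simp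
  have "continuous_map (prod_topology X Z) W (f \<circ> (\<lambda>(x, z). (collapse_map A x, z)))"
    by (rule continuous_map_eq[OF f]) auto
  then show ?thesis
    using q by (metis continuous_compose_quotient_map)
next
  case True
  let ?P = "ptop (collapse X A)"
  \<comment> \<open>The product is now a disjoint union of two open sets: the slice over the
    isolated base point, where \<open>base\<close> applies, and a copy of
    \<open>X \<times> Z\<close>, where \<open>f\<close> applies.\<close>
  let ?T = "\<lambda>b. (if b then {A} else points (collapse X A) - {A}) \<times> topspace Z"
  have cm: "collapse_map A x = {x}" if "x \<in> topspace X" for x
    using True that by (auto simp: collapse_map_def)
  have emp: "{x \<in> topspace X. collapse_map A x = A} = {}"
    using True by (auto simp: collapse_map_def)
  have rest: "{x \<in> topspace X. collapse_map A x \<in> points (collapse X A) \<and> collapse_map A x \<noteq> A} = topspace X"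
    using emp by (auto simp: points_collapse)
  have op: "openin ?P {A}" "openin ?P (points (collapse X A) - {A})"
  proof -
    have "{x \<in> topspace X. collapse_map A x \<in> {A}} = {}"
      using emp by blast
    then show "openin ?P {A}"
      unfolding openin_collapse by (simp only: openin_empty) simp
    have "{x \<in> topspace X. collapse_map A x \<in> points (collapse X A) - {A}} = topspace X"
      using rest by auto
    then show "openin ?P (points (collapse X A) - {A})"
      unfolding openin_collapse by (auto simp: points_collapse)
  qed
  show ?thesis
  proof (rule pasting_lemma[where I = UNIV and T = ?T and f = "\<lambda>_. f"])
    show "openin (prod_topology ?P Z) (?T b)" for b
      using op by (auto simp: openin_prod_Times_iff)
    show "continuous_map (subtopology (prod_topology ?P Z) (?T b)) W f" for b
    proof (cases b)
      case True
      have "continuous_map (subtopology (prod_topology ?P Z) (?T b)) Z snd"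
        by (intro continuous_map_from_subtopology continuous_map_snd)
      from continuous_map_compose[OF this base] show ?thesis
        by (rule continuous_map_eq) (use True in auto)
    next
      case False
      have "subtopology (prod_topology ?P Z) (?T b) =
          prod_topology (subtopology ?P (points (collapse X A) - {A})) Z"
        using False by (simp add: prod_topology_subtopology)
      moreover have "continuous_map \<dots> (prod_topology X Z) (\<lambda>(p, z). (the_elem p, z))"
        unfolding continuous_map_prod_top
        by (intro disjI2 conjI continuous_map_the_elem_collapse continuous_map_id[unfolded id_def] True)
      ultimately have "continuous_map (subtopology (prod_topology ?P Z) (?T b)) W
          ((\<lambda>(x, z). f (collapse_map A x, z)) \<circ> (\<lambda>(p, z). (the_elem p, z)))"
        using continuous_map_compose f by metis
      then show ?thesis
        by (rule continuous_map_eq) (use False in \<open>auto simp: points_collapse cm\<close>)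
    qed
  qed (use op in \<open>auto\<close>)
qed

text \<open>Continuity on a k-space can be tested on compact sets. A compact set of the product has
  a compact Hausdorff projection to \<open>Z\<close>; replacing \<open>Z\<close> by this projection
  gives a locally compact factor, to which Whitehead's theorem applies. The other factor stays
  whole.\<close>

lemma continuous_map_kification_prod_collapse_left:
  assumes X: "k_space X" and Z: "Hausdorff_space Z"
    and base: "continuous_map Z W (\<lambda>z. f (A, z))"
    and f: "continuous_map (kification (prod_topology X Z)) W (\<lambda>(x, z). f (collapse_map A x, z))"
  shows "continuous_map (kification (prod_topology (ptop (collapse X A)) Z)) W f"
proof (rule continuous_map_from_k_space)
  let ?P = "ptop (collapse X A)"
  fix K assume "compactin (kification (prod_topology ?P Z)) K"
  then have K: "compactin (prod_topology ?P Z) K" by simp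
  let ?Z = "subtopology Z (snd ` K)"
  have comp: "compactin Z (snd ` K)"
    using K by (rule image_compactin) (rule continuous_map_snd)
  then have loc: "locally_compact_space ?Z" "Hausdorff_space ?Z"
    using Z by (auto simp: Hausdorff_space_subtopology compact_space_subtopology
        intro!: compact_imp_locally_compact_space)
  \<comment> \<open>A k-space times a locally compact Hausdorff space is a k-space, so over
    \<open>?Z\<close> the ordinary product maps continuously into the kification and
    \<open>f\<close> can be restricted to it.\<close>
  have k: "k_space (prod_topology X ?Z)"
    using k_space_prod_topology_right X loc by blast
  then have "continuous_map (prod_topology X ?Z) (kification (prod_topology X Z)) (\<lambda>x. x)"
    unfolding continuous_map_into_kification[OF k]
    by (metis continuous_map_from_subtopology continuous_map_id[unfolded id_def] prod_topology_subtopology(2))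
  from continuous_map_compose[OF this f]
  have "continuous_map (prod_topology X ?Z) W (\<lambda>(x, z). f (collapse_map A x, z))"
    by (simp add: o_def)
  then have "continuous_map (prod_topology ?P ?Z) W f"
    using continuous_map_prod_collapse[OF loc continuous_map_from_subtopology[OF base]] by blast
  then have "continuous_map (subtopology (prod_topology ?P Z) (topspace ?P \<times> snd ` K)) W f"
    by (metis prod_topology_subtopology(2) subtopology_Times subtopology_topspace)
  moreover have "K \<subseteq> topspace ?P \<times> snd ` K"
    using compactin_subset_topspace[OF K] by (force simp: image_iff)
  ultimately show "continuous_map (subtopology (kification (prod_topology ?P Z)) K) W f"
    unfolding subtopology_kification_compact[OF K]
    using continuous_map_from_subtopology_mono by blast
qed (rule k_space_kification)

lemma continuous_map_kification_prod_collapse_right: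
  assumes X: "k_space X" and Z: "Hausdorff_space Z"
    and base: "continuous_map Z W (\<lambda>z. f (z, A))"
    and f: "continuous_map (kification (prod_topology Z X)) W (\<lambda>(z, x). f (z, collapse_map A x))"
  shows "continuous_map (kification (prod_topology Z (ptop (collapse X A)))) W f"
proof -
  have swap: "continuous_map (kification (prod_topology S T)) (kification (prod_topology T S)) (\<lambda>(x, y). (y, x))"
    for S :: "'p topology" and T :: "'q topology"
    by (rule continuous_map_kification) (simp add: case_prod_unfold continuous_map_pairedI
        continuous_map_fst continuous_map_snd)
  have "continuous_map (kification (prod_topology (ptop (collapse X A)) Z)) W (\<lambda>(x, z). f (z, x))"
    using continuous_map_compose[OF swap f] base
    by (intro continuous_map_kification_prod_collapse_left X Z) (auto simp: o_def case_prod_unfold)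
  from continuous_map_compose[OF swap this] show ?thesis
    by (simp add: o_def case_prod_unfold)
qed

section \<open>Hausdorff collapses and maps out of disjoint unions\<close>

text \<open>Instead of regularity of \<open>X\<close>, points are separated from this one
  \<open>A\<close> only; for the fat wedge that can be done coordinatewise. Two points outside
  \<open>A\<close> are separated by neighbourhoods from which the closed set \<open>A\<close> is
  removed, which makes them saturated.\<close>

lemma Hausdorff_space_collapse:
  assumes X: "Hausdorff_space X" and A: "closedin X A"
    and sep: "\<And>x. x \<in> topspace X - A \<Longrightarrow> \<exists>U V. openin X U \<and> openin X V \<and> x \<in> U \<and> A \<subseteq> V \<and> disjnt U V"
  shows "Hausdorff_space (ptop (collapse X A))"
proof -
  let ?Y = "ptop (collapse X A)"
  let ?S = "\<lambda>p q. \<exists>U V. openin ?Y U \<and> openin ?Y V \<and> p \<in> U \<and> q \<in> V \<and> disjnt U V"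
  have base: "?S {x} A" if x: "x \<in> topspace X - A" for x
  proof -
    obtain U V where UV: "openin X U" "openin X V" "x \<in> U" "A \<subseteq> V" "disjnt U V"
      using sep[OF x] by blast
    then have UA: "U \<inter> A = {}" by (auto simp: disjnt_iff)
    have "disjnt (collapse_map A ` U) (insert A (collapse_map A ` V))"
      using UV UA by (auto simp: disjnt_iff collapse_map_def split: if_splits)
    moreover have "{x} \<in> collapse_map A ` U"
      using UV(3) x by (force simp: collapse_map_def)
    ultimately show ?thesis
      using openin_collapse_image(1)[OF UV(1), of A] openin_collapse_image(2)[OF UV(2), of A] UA UV(4)
      by blast
  qed
  have points: "?S {x} {y}" if xy: "x \<in> topspace X - A" "y \<in> topspace X - A" "x \<noteq> y" for x y
  proof -
    obtain U V where UV: "openin X U" "openin X V" "x \<in> U" "y \<in> V" "disjnt U V"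
      using X xy unfolding Hausdorff_space_def by (metis DiffD1)
    let ?U = "U - A" and ?V = "V - A"
    have op: "openin X ?U" "openin X ?V"
      using UV A by auto
    have "disjnt (collapse_map A ` ?U) (collapse_map A ` ?V)"
      using UV by (auto simp: disjnt_iff collapse_map_def split: if_splits)
    moreover have "{x} \<in> collapse_map A ` ?U" "{y} \<in> collapse_map A ` ?V"
      using UV(3,4) xy by (force simp: collapse_map_def)+
    ultimately show ?thesis
      using openin_collapse_image(1)[OF op(1), of A] openin_collapse_image(1)[OF op(2), of A]
      by blast
  qed
  have sym: "?S p q" if "?S q p" for p q
    using that disjnt_sym by blast
  show ?thesis
    unfolding Hausdorff_space_def
  proof (intro allI impI, elim conjE)
    fix p q assume pq: "p \<in> topspace ?Y" "q \<in> topspace ?Y" "p \<noteq> q"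
    have cases: "r = A \<or> (\<exists>x \<in> topspace X - A. r = {x})" if "r \<in> topspace ?Y" for r
      using that by (auto simp: points_collapse collapse_map_def)
    show "?S p q"
    proof (cases "p = A")
      case True
      then obtain y where y: "y \<in> topspace X - A" "q = {y}"
        using cases[OF pq(2)] pq(3) by blast
      show ?thesis
        unfolding True y(2) by (rule sym[OF base[OF y(1)]])
    next
      case False
      then obtain x where x: "x \<in> topspace X - A" "p = {x}"
        using cases[OF pq(1)] by blast
      show ?thesis
      proof (cases "q = A")
        case True
        show ?thesis
          unfolding True x(2) by (rule base[OF x(1)])
      next
        case False
        then obtain y where y: "y \<in> topspace X - A" "q = {y}"
          using cases[OF pq(2)] by blast
        then have "x \<noteq> y"
          using x pq(3) by blast
        then show ?thesis
          unfolding x(2) y(2) using points[OF x(1) y(1)] by blast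
      qed
    qed
  qed
qed

lemma continuous_map_sum_topology:
  assumes "\<And>i. i \<in> I \<Longrightarrow> continuous_map (X i) Y (\<lambda>x. f (i, x))"
  shows "continuous_map (sum_topology X I) Y f"
  unfolding continuous_map_def openin_sum_topology
proof (intro conjI allI impI ballI)
  show "f \<in> topspace (sum_topology X I) \<rightarrow> topspace Y"
    using assms by (fastforce simp: continuous_map_def)
  fix U assume U: "openin Y U"
  show "{p \<in> topspace (sum_topology X I). f p \<in> U} \<subseteq> Sigma I (topspace \<circ> X)"
    by auto
  fix i assume i: "i \<in> I"
  then have "{x. (i, x) \<in> {p \<in> topspace (sum_topology X I). f p \<in> U}} = {x \<in> topspace (X i). f (i, x) \<in> U}"
    by auto
  then show "openin (X i) {x. (i, x) \<in> {p \<in> topspace (sum_topology X I). f p \<in> U}}"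
    using assms[OF i] U by (simp add: continuous_map_def)
qed

lemma continuous_map_sum_topology_inclusion:
  "i \<in> I \<Longrightarrow> continuous_map (X i) (sum_topology X I) (Pair i)"
  unfolding continuous_map_def
proof (intro conjI allI impI)
  assume i: "i \<in> I"
  then show "Pair i \<in> topspace (X i) \<rightarrow> topspace (sum_topology X I)"
    by auto
  fix U assume U: "openin (sum_topology X I) U"
  then have "openin (X i) {x. (i, x) \<in> U}"
    using i by (simp add: openin_sum_topology)
  moreover from this have "{x \<in> topspace (X i). (i, x) \<in> U} = {x. (i, x) \<in> U}"
    using openin_subset by blast
  ultimately show "openin (X i) {x \<in> topspace (X i). (i, x) \<in> U}"
    by simp
qed

section \<open>CW complexes and wedges\<close>

lemma compact_space_disc: "compact_space (disc n)"
proof -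
  let ?D = "{x \<in> topspace (Euclidean_space n). (\<Sum>i<n. (x i)\<^sup>2) \<le> 1}"
  \<comment> \<open>Points of \<open>Euclidean_space n\<close> are sequences vanishing from index
    \<open>n\<close> on, hence the factors \<open>{0}\<close>. The box is compact by Tychonoff's
    theorem and contains the disc.\<close>
  let ?box = "PiE UNIV (\<lambda>i. if i < n then {-1..1} else {0::real})"
  have box: "compactin (powertop_real UNIV) ?box"
    by (subst compactin_PiE) auto
  have sub: "?D \<subseteq> ?box"
  proof
    fix x assume x: "x \<in> ?D"
    have "x i \<in> {-1..1}" if "i < n" for i
    proof -
      have "(x i)\<^sup>2 \<le> (\<Sum>i<n. (x i)\<^sup>2)"
        using that by (intro member_le_sum) auto
      then have "(x i)\<^sup>2 \<le> 1"
        using x by simp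
      then show ?thesis
        using abs_square_le_1[of "x i"] by auto
    qed
    then show "x \<in> ?box"
      using x by (auto simp: topspace_Euclidean_space PiE_def)
  qed
  have "continuous_map (powertop_real UNIV) euclideanreal (\<lambda>x. \<Sum>i<n. (x i)\<^sup>2)"
    by (intro continuous_intros continuous_map_product_projection) auto
  then have "closedin (powertop_real UNIV) {x \<in> topspace (powertop_real UNIV). (\<Sum>i<n. (x i)\<^sup>2) \<in> {..1}}"
    by (rule closedin_continuous_map_preimage) simp
  moreover have "closedin (powertop_real UNIV) (topspace (Euclidean_space n))"
    by (rule closedin_Euclidean_space)
  ultimately have "closedin (powertop_real UNIV)
      (topspace (Euclidean_space n) \<inter> {x \<in> topspace (powertop_real UNIV). (\<Sum>i<n. (x i)\<^sup>2) \<in> {..1}})"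
    by blast
  then have "closedin (powertop_real UNIV) ?D"
    by (simp add: Int_def)
  then have "compactin (powertop_real UNIV) ?D"
    by (rule closed_compactin[OF box sub])
  moreover have "disc n = subtopology (powertop_real UNIV) ?D"
    unfolding disc_def Euclidean_space_def subtopology_subtopology topspace_subtopology
    by (rule arg_cong[where f = "subtopology _"]) auto
  ultimately show ?thesis
    by (simp add: compact_space_subtopology)
qed

lemma CW_structureD:
  assumes "CW_structure X \<E>"
  shows "Hausdorff_space X"
    and "(\<Union>n. \<Union>(\<E> n)) = topspace X"
    and "\<And>n n' e e'. \<lbrakk>e \<in> \<E> n; e' \<in> \<E> n'; (n, e) \<noteq> (n', e')\<rbrakk> \<Longrightarrow> e \<inter> e' = {}"
    and "\<And>n e. e \<in> \<E> n \<Longrightarrow> \<exists>\<phi>. continuous_map (disc n) X \<phi> \<and>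
        homeomorphic_map (subtopology (disc n) (open_disc n)) (subtopology X e) \<phi> \<and>
        (\<exists>F. finite F \<and> F \<subseteq> (\<Union>k<n. \<E> k) \<and> \<phi> ` disc_boundary n \<subseteq> \<Union>F)"
    and "\<And>S. \<lbrakk>S \<subseteq> topspace X; \<And>n e. e \<in> \<E> n \<Longrightarrow> closedin X (S \<inter> X closure_of e)\<rbrakk> \<Longrightarrow> closedin X S"
proof -
  note D = assms[unfolded CW_structure_def]
  note D' = D[THEN conjunct2, THEN conjunct2]
  show "Hausdorff_space X"
    by (rule D[THEN conjunct1])
  show "(\<Union>n. \<Union>(\<E> n)) = topspace X"
    by (rule D[THEN conjunct2, THEN conjunct1])
  show "\<And>n n' e e'. \<lbrakk>e \<in> \<E> n; e' \<in> \<E> n'; (n, e) \<noteq> (n', e')\<rbrakk> \<Longrightarrow> e \<inter> e' = {}"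
    by (rule D'[THEN conjunct1, rule_format]) (intro conjI)
  show "\<And>n e. e \<in> \<E> n \<Longrightarrow> \<exists>\<phi>. continuous_map (disc n) X \<phi> \<and>
        homeomorphic_map (subtopology (disc n) (open_disc n)) (subtopology X e) \<phi> \<and>
        (\<exists>F. finite F \<and> F \<subseteq> (\<Union>k<n. \<E> k) \<and> \<phi> ` disc_boundary n \<subseteq> \<Union>F)"
    by (rule D'[THEN conjunct2, THEN conjunct1, THEN spec, THEN bspec])
  show "\<And>S. \<lbrakk>S \<subseteq> topspace X; \<And>n e. e \<in> \<E> n \<Longrightarrow> closedin X (S \<inter> X closure_of e)\<rbrakk> \<Longrightarrow> closedin X S"
    by (rule D'[THEN conjunct2, THEN conjunct2, THEN spec, THEN mp]) (intro conjI allI ballI)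
qed

lemma CW_cell_subset:
  assumes "CW_structure X \<E>" "e \<in> \<E> n"
  shows "e \<subseteq> topspace X"
  unfolding CW_structureD(2)[OF assms(1), symmetric] using assms(2) by blast

text \<open>The image of the disc under the characteristic map is compact, hence closed, and so
  contains the closure of \<open>e\<close>. It is \<open>e\<close> itself together with the image of
  the boundary, which finitely many lower cells cover.\<close>

lemma CW_closure_of_cell:
  assumes X: "CW_structure X \<E>" and e: "e \<in> \<E> n"
  obtains F where "finite F" "F \<subseteq> (\<Union>k. \<E> k)" "X closure_of e \<subseteq> \<Union>F"
proof -
  have H: "Hausdorff_space X"
    by (rule CW_structureD(1)[OF X])
  obtain \<phi> F where \<phi>: "continuous_map (disc n) X \<phi>"
      "homeomorphic_map (subtopology (disc n) (open_disc n)) (subtopology X e) \<phi>"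
      and F: "finite F" "F \<subseteq> (\<Union>k<n. \<E> k)" "\<phi> ` disc_boundary n \<subseteq> \<Union>F"
    using CW_structureD(4)[OF X e] by (elim exE conjE) blast
  have "e \<subseteq> topspace X"
    by (rule CW_cell_subset[OF X e])
  moreover have "open_disc n \<subseteq> topspace (disc n)"
    by (auto simp: open_disc_def)
  ultimately have im: "\<phi> ` open_disc n = e"
    using homeomorphic_imp_surjective_map[OF \<phi>(2)] by (simp add: Int_absorb1)
  have "compactin X (\<phi> ` topspace (disc n))"
    using compact_space_disc \<phi>(1) by (auto simp: compact_space_def intro: image_compactin)
  then have "closedin X (\<phi> ` topspace (disc n))"
    using H compactin_imp_closedin by blast
  moreover have "e \<subseteq> \<phi> ` topspace (disc n)"
    using im \<open>open_disc n \<subseteq> topspace (disc n)\<close> by blast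
  ultimately have "X closure_of e \<subseteq> \<phi> ` topspace (disc n)"
    by (simp add: closure_of_minimal)
  also have "topspace (disc n) = open_disc n \<union> disc_boundary n"
    by (force simp: open_disc_def disc_boundary_def disc_def)
  also have "\<phi> ` \<dots> \<subseteq> \<Union>(insert e F)"
    using F(3) im by (auto simp: image_Un)
  finally have "X closure_of e \<subseteq> \<Union>(insert e F)" .
  moreover have "insert e F \<subseteq> (\<Union>k. \<E> k)"
    using F(2) e by blast
  ultimately show ?thesis
    using that[of "insert e F"] F(1) by simp
qed

text \<open>By the weak topology it suffices to intersect with the closure of one cell. That closure
  is covered by finitely many cells; since cells are disjoint, those meeting \<open>A\<close> belong
  to the subcomplex, and their closures stay inside \<open>A\<close>. The intersection is thus a
  finite union of closed sets.\<close>

lemma CW_subcomplex_closedin: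
  assumes X: "CW_structure X \<E>" and A: "CW_subcomplex X \<E> A"
  shows "closedin X A"
proof -
  obtain \<F> where \<F>: "\<And>n. \<F> n \<subseteq> \<E> n" "A = (\<Union>n. \<Union>(\<F> n))"
      "\<And>n e. e \<in> \<F> n \<Longrightarrow> X closure_of e \<subseteq> A"
    using A unfolding CW_subcomplex_def by metis
  have disj: "e \<inter> e' = {}" if "e \<in> \<E> n" "e' \<in> \<E> n'" "(n, e) \<noteq> (n', e')" for n n' e e'
    by (rule CW_structureD(3)[OF X that])
  have cells: "e \<subseteq> topspace X" if "e \<in> \<E> n" for n e
    by (rule CW_cell_subset[OF X that])
  have sub: "A \<subseteq> topspace X"
    using cells \<F>(1,2) by blast
  have "closedin X (A \<inter> X closure_of e)" if e: "e \<in> \<E> n" for n e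
  proof -
    obtain F where F: "finite F" "F \<subseteq> (\<Union>k. \<E> k)" "X closure_of e \<subseteq> \<Union>F"
      using CW_closure_of_cell[OF X e] .
    let ?G = "{f \<in> F. \<exists>k. f \<in> \<F> k}"
    have "A \<inter> X closure_of e = (\<Union>f\<in>?G. X closure_of f \<inter> X closure_of e)"
    proof
      show "A \<inter> X closure_of e \<subseteq> (\<Union>f\<in>?G. X closure_of f \<inter> X closure_of e)"
      proof
        fix x assume x: "x \<in> A \<inter> X closure_of e"
        then obtain f k where f: "f \<in> F" "f \<in> \<E> k" "x \<in> f"
          using F by blast
        obtain f' k' where f': "f' \<in> \<F> k'" "x \<in> f'"
          using x \<F>(2) by blast
        have "f' = f"
          using disj[OF f(2), of f' k'] f f' \<F>(1) by blast
        moreover have "x \<in> X closure_of f"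
          using closure_of_subset[OF cells[OF f(2)]] f(3) by blast
        ultimately show "x \<in> (\<Union>f\<in>?G. X closure_of f \<inter> X closure_of e)"
          using f f' x by blast
      qed
    qed (use \<F>(3) in blast)
    moreover have "closedin X (\<Union>f\<in>?G. X closure_of f \<inter> X closure_of e)"
      using F(1) by (intro closedin_Union) auto
    ultimately show ?thesis
      by simp
  qed
  then show ?thesis
    by (rule CW_structureD(5)[OF X sub])
qed

text \<open>The interface to CW pairs: the arguments about smash products below are point-set
  topology and take these facts as input.\<close>

lemma pointed_CW_pairD:
  assumes "pointed_CW_pair X A"
  shows "Hausdorff_space (ptop X)" "closedin (ptop X) A" "pbase X \<in> A" "pbase X \<in> points X"
proof -
  obtain \<E> where \<E>: "CW_structure (ptop X) \<E>" "CW_subcomplex (ptop X) \<E> A" "pbase X \<in> A"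
    using assms unfolding pointed_CW_pair_def by blast
  show "Hausdorff_space (ptop X)" "closedin (ptop X) A" "pbase X \<in> A"
    using CW_structureD(1)[OF \<E>(1)] CW_subcomplex_closedin[OF \<E>(1,2)] \<E>(3) by auto
  then show "pbase X \<in> points X"
    using closedin_subset by blast
qed

section \<open>Disjoint sums and wedges of two spaces\<close>

lemma topspace_disjoint_sum [simp]:
  "topspace (disjoint_sum X Y) = Inl ` topspace X \<union> Inr ` topspace Y"
proof -
  have "openin (disjoint_sum X Y) (Inl ` topspace X \<union> Inr ` topspace Y)"
    unfolding openin_disjoint_sum by (simp add: vimage_Un vimage_image_eq inj_vimage_image_eq
        vimage_def image_iff Collect_disj_eq)
  moreover have "U \<subseteq> Inl ` topspace X \<union> Inr ` topspace Y" if "openin (disjoint_sum X Y) U" for U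
  proof
    fix u assume u: "u \<in> U"
    have "Inl -` U \<subseteq> topspace X" "Inr -` U \<subseteq> topspace Y"
      using that unfolding openin_disjoint_sum by (simp_all add: openin_subset)
    then show "u \<in> Inl ` topspace X \<union> Inr ` topspace Y"
      using u by (cases u) auto
  qed
  ultimately show ?thesis
    by (metis openin_subset openin_topspace subset_antisym)
qed

lemma continuous_map_Inl: "continuous_map X (disjoint_sum X Y) Inl"
  unfolding continuous_map_def openin_disjoint_sum
proof (intro conjI allI impI)
  fix U :: "('a + 'b) set" assume "openin X (Inl -` U) \<and> openin Y (Inr -` U)"
  moreover from this have "{x \<in> topspace X. Inl x \<in> U} = Inl -` U"
    using openin_subset by blast
  ultimately show "openin X {x \<in> topspace X. Inl x \<in> U}"
    by simp
qed simp

lemma continuous_map_Inr: "continuous_map Y (disjoint_sum X Y) Inr"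
  unfolding continuous_map_def openin_disjoint_sum
proof (intro conjI allI impI)
  fix U :: "('b + 'a) set" assume "openin X (Inl -` U) \<and> openin Y (Inr -` U)"
  moreover from this have "{x \<in> topspace Y. Inr x \<in> U} = Inr -` U"
    using openin_subset by blast
  ultimately show "openin Y {x \<in> topspace Y. Inr x \<in> U}"
    by simp
qed simp

lemma continuous_map_case_sum:
  assumes "continuous_map X Z f" "continuous_map Y Z g"
  shows "continuous_map (disjoint_sum X Y) Z (case_sum f g)"
  unfolding continuous_map_def openin_disjoint_sum
proof (intro conjI allI impI)
  show "case_sum f g \<in> topspace (disjoint_sum X Y) \<rightarrow> topspace Z"
    using assms by (auto simp: continuous_map_def)
  fix U assume U: "openin Z U"
  have "Inl -` {p \<in> topspace (disjoint_sum X Y). case_sum f g p \<in> U} = {x \<in> topspace X. f x \<in> U}"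
       "Inr -` {p \<in> topspace (disjoint_sum X Y). case_sum f g p \<in> U} = {y \<in> topspace Y. g y \<in> U}"
    by auto
  then show "openin X (Inl -` {p \<in> topspace (disjoint_sum X Y). case_sum f g p \<in> U})"
       "openin Y (Inr -` {p \<in> topspace (disjoint_sum X Y). case_sum f g p \<in> U})"
    using assms U by (simp_all add: continuous_map_def)
qed

lemma closedin_disjoint_sum:
  "closedin (disjoint_sum X Y) S \<longleftrightarrow> closedin X (Inl -` S) \<and> closedin Y (Inr -` S)"
proof -
  have "Inl -` (topspace (disjoint_sum X Y) - S) = topspace X - Inl -` S"
       "Inr -` (topspace (disjoint_sum X Y) - S) = topspace Y - Inr -` S"
    by auto
  moreover have "S \<subseteq> topspace (disjoint_sum X Y) \<longleftrightarrow> Inl -` S \<subseteq> topspace X \<and> Inr -` S \<subseteq> topspace Y"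
  proof -
    have "s \<in> topspace (disjoint_sum X Y)"
      if "Inl -` S \<subseteq> topspace X" "Inr -` S \<subseteq> topspace Y" "s \<in> S" for s
      using that by (cases s) auto
    then show ?thesis by auto
  qed
  ultimately show ?thesis
    unfolding closedin_def openin_disjoint_sum by auto
qed

definition wedge_inl :: "'a pointed \<Rightarrow> 'b pointed \<Rightarrow> 'a \<Rightarrow> ('a + 'b) set" where
  "wedge_inl X Y x = collapse_map (wedge_base X Y) (Inl x)"

definition wedge_inr :: "'a pointed \<Rightarrow> 'b pointed \<Rightarrow> 'b \<Rightarrow> ('a + 'b) set" where
  "wedge_inr X Y y = collapse_map (wedge_base X Y) (Inr y)"

text \<open>This map and \<open>wedge_snd\<close> are the two retractions of
  \<open>X \<or> Y\<close> that pinch the other summand to the base point.\<close>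

definition wedge_fst :: "'a pointed \<Rightarrow> 'b pointed \<Rightarrow> ('a + 'b) set \<Rightarrow> 'a" where
  "wedge_fst X Y = collapse_lift (wedge_base X Y) (pbase X) (case_sum (\<lambda>x. x) (\<lambda>_. pbase X))"

definition wedge_snd :: "'a pointed \<Rightarrow> 'b pointed \<Rightarrow> ('a + 'b) set \<Rightarrow> 'b" where
  "wedge_snd X Y = collapse_lift (wedge_base X Y) (pbase Y) (case_sum (\<lambda>_. pbase Y) (\<lambda>y. y))"

lemma wedge_fst_simps [simp]:
  "wedge_fst X Y (wedge_base X Y) = pbase X"
  "wedge_fst X Y (wedge_inl X Y x) = x"
  "wedge_fst X Y (wedge_inr X Y y) = pbase X"
  by (auto simp: wedge_fst_def wedge_inl_def wedge_inr_def collapse_lift_collapse_map)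
    (auto simp: wedge_base_def)

lemma wedge_snd_simps [simp]:
  "wedge_snd X Y (wedge_base X Y) = pbase Y"
  "wedge_snd X Y (wedge_inl X Y x) = pbase Y"
  "wedge_snd X Y (wedge_inr X Y y) = y"
  by (auto simp: wedge_snd_def wedge_inl_def wedge_inr_def collapse_lift_collapse_map)
    (auto simp: wedge_base_def)

lemma wedge_in_eq_base [simp]:
  "wedge_inl X Y x = wedge_base X Y \<longleftrightarrow> x = pbase X"
  "wedge_inr X Y y = wedge_base X Y \<longleftrightarrow> y = pbase Y"
  by (auto simp: wedge_inl_def wedge_inr_def wedge_base_def collapse_map_def)

lemma pbase_wedge [simp]: "pbase (wedge X Y) = wedge_base X Y"
  by (simp add: wedge_def)

lemma wedge_map_simps [simp]:
  "wedge_map X Y X' Y' f g (wedge_base X Y) = wedge_base X' Y'"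
  "f (pbase X) = pbase X' \<Longrightarrow> wedge_map X Y X' Y' f g (wedge_inl X Y x) = wedge_inl X' Y' (f x)"
  "g (pbase Y) = pbase Y' \<Longrightarrow> wedge_map X Y X' Y' f g (wedge_inr X Y y) = wedge_inr X' Y' (g y)"
  by (auto simp: wedge_map_def wedge_inl_def wedge_inr_def collapse_induced_eq_lift
      collapse_lift_collapse_map wedge_base_def) (auto simp: collapse_map_def)

lemma wedge_subset_eq: "wedge_subset X Y A A' = wedge_inl X Y ` A \<union> wedge_inr X Y ` A'"
  by (simp add: wedge_subset_def wedge_inl_def wedge_inr_def image_Un image_image)

lemma points_wedge:
  assumes "pbase X \<in> points X"
  shows "points (wedge X Y) = wedge_inl X Y ` points X \<union> wedge_inr X Y ` points Y"
proof -
  have "wedge_inl X Y (pbase X) = wedge_base X Y"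
    by simp
  then have "wedge_base X Y \<in> wedge_inl X Y ` points X"
    using assms by (metis imageI)
  then show ?thesis
    by (auto simp: wedge_def points_collapse image_Un image_image
        wedge_inl_def[symmetric] wedge_inr_def[symmetric])
qed

lemma continuous_map_wedge_inl: "continuous_map (ptop X) (ptop (wedge X Y)) (wedge_inl X Y)"
  using continuous_map_compose[OF continuous_map_Inl continuous_map_collapse_map]
  by (simp add: wedge_def wedge_inl_def[abs_def] o_def)

lemma continuous_map_wedge_inr: "continuous_map (ptop Y) (ptop (wedge X Y)) (wedge_inr X Y)"
  using continuous_map_compose[OF continuous_map_Inr continuous_map_collapse_map]
  by (simp add: wedge_def wedge_inr_def[abs_def] o_def)

lemma continuous_map_wedge_fst:
  assumes "pbase X \<in> points X"
  shows "continuous_map (ptop (wedge X Y)) (ptop X) (wedge_fst X Y)"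
  unfolding wedge_def wedge_fst_def using assms
  by (intro continuous_map_collapse_lift continuous_map_case_sum) (auto simp: wedge_base_def)

lemma continuous_map_wedge_snd:
  assumes "pbase Y \<in> points Y"
  shows "continuous_map (ptop (wedge X Y)) (ptop Y) (wedge_snd X Y)"
  unfolding wedge_def wedge_snd_def using assms
  by (intro continuous_map_collapse_lift continuous_map_case_sum) (auto simp: wedge_base_def)

text \<open>Both sets contain their base points, so the preimage in the disjoint sum is just
  \<open>Inl\<close> A \<union> Inr \<open>A'\<close>.\<close>

lemma closedin_wedge_subset:
  assumes "closedin (ptop X) A" "pbase X \<in> A" "closedin (ptop Y) A'" "pbase Y \<in> A'"
  shows "closedin (ptop (wedge X Y)) (wedge_subset X Y A A')"
proof -
  have sub: "A \<subseteq> points X" "A' \<subseteq> points Y"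
    using assms closedin_subset by blast+
  let ?T = "disjoint_sum (ptop X) (ptop Y)"
  have "{x \<in> topspace ?T. collapse_map (wedge_base X Y) x \<in> wedge_subset X Y A A'} = Inl ` A \<union> Inr ` A'"
    using sub assms(2,4) unfolding wedge_subset_def
    by (auto simp: collapse_map_def wedge_base_def split: if_splits)
  moreover have "Inl -` (Inl ` A \<union> Inr ` A') = A" "Inr -` (Inl ` A \<union> Inr ` A') = A'"
    by auto
  moreover have "wedge_subset X Y A A' \<subseteq> points (wedge X Y)"
    using sub by (auto simp: wedge_subset_def wedge_def points_collapse)
  ultimately show ?thesis
    unfolding wedge_def closedin_collapse using assms by (simp add: closedin_disjoint_sum)
qed

text \<open>With \<open>{pbase X}\<close> on the left, \<open>wedge_subset\<close> is a copy of
  \<open>Q\<close> in the second summand with the base point added; pinching the first summand loses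
  nothing there.\<close>

lemma wedge_inr_snd:
  assumes "w \<in> wedge_subset X Y {pbase X} Q"
  shows "wedge_inr X Y (wedge_snd X Y w) = w"
proof (cases "w = wedge_base X Y")
  case False
  then obtain y where "w = wedge_inr X Y y"
    using assms unfolding wedge_subset_eq by (metis UnE imageE singletonD wedge_in_eq_base(1))
  then show ?thesis
    by simp
qed simp

lemma wedge_inl_fst:
  assumes "w \<in> wedge_subset X Y P {pbase Y}"
  shows "wedge_inl X Y (wedge_fst X Y w) = w"
proof (cases "w = wedge_base X Y")
  case False
  then obtain x where "w = wedge_inl X Y x"
    using assms unfolding wedge_subset_eq by (metis UnE imageE singletonD wedge_in_eq_base(2))
  then show ?thesis
    by simp
qed simp

section \<open>Polyhedral smash products as collapses\<close>

definition poly_blocks ::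
    "nat set \<Rightarrow> nat set set \<Rightarrow> (nat \<Rightarrow> 'a pointed) \<Rightarrow> (nat \<Rightarrow> 'a set) \<Rightarrow> (nat \<Rightarrow> 'a) set" where
  "poly_blocks I K X A = (\<Union>\<sigma>\<in>K. PiE I (\<lambda>i. if i \<in> \<sigma> then points (X i) else A i))"

text \<open>The preimage of the polyhedral smash product in the product, before collapsing. The
  whole fat wedge is included, so that the set to be collapsed is the same as for
  \<open>big_smash\<close>.\<close>

definition poly_space ::
    "nat set \<Rightarrow> nat set set \<Rightarrow> (nat \<Rightarrow> 'a pointed) \<Rightarrow> (nat \<Rightarrow> 'a set) \<Rightarrow> (nat \<Rightarrow> 'a) topology" where
  "poly_space I K X A =
     subtopology (kification (product_topology (\<lambda>i. ptop (X i)) I)) (fat_wedge I X \<union> poly_blocks I K X A)"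

text \<open>These conditions make the fat wedge and the blocks closed, so that the subspaces
  involved are again k-spaces and restricting commutes with collapsing.\<close>

definition closed_pairs :: "'i set \<Rightarrow> ('i \<Rightarrow> 'a pointed) \<Rightarrow> ('i \<Rightarrow> 'a set) \<Rightarrow> bool" where
  "closed_pairs I X A \<longleftrightarrow>
     finite I \<and> (\<forall>i\<in>I. closedin (ptop (X i)) {pbase (X i)} \<and> closedin (ptop (X i)) (A i))"

lemma continuous_map_pointed_projection:
  "i \<in> I \<Longrightarrow> continuous_map (product_topology (\<lambda>i. ptop (X i)) I) (ptop (X i)) (\<lambda>x. x i)"
  using continuous_map_product_projection[of i I "\<lambda>i. ptop (X i)"] by simp

lemma fat_wedge_subset: "fat_wedge I X \<subseteq> PiE I (\<lambda>i. points (X i))"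
  by (auto simp: fat_wedge_def)

lemma poly_blocks_subset:
  assumes "closed_pairs I X A"
  shows "poly_blocks I K X A \<subseteq> PiE I (\<lambda>i. points (X i))"
proof -
  have "A i \<subseteq> points (X i)" if "i \<in> I" for i
    using assms that closedin_subset unfolding closed_pairs_def by blast
  then show ?thesis
    unfolding poly_blocks_def by (intro UN_least PiE_mono) auto
qed

lemma closedin_fat_wedge:
  assumes "closed_pairs I X A"
  shows "closedin (kification (product_topology (\<lambda>i. ptop (X i)) I)) (fat_wedge I X)"
proof (rule closedin_kification_finer)
  let ?P = "product_topology (\<lambda>i. ptop (X i)) I"
  have "fat_wedge I X = (\<Union>i\<in>I. {x \<in> topspace ?P. x i \<in> {pbase (X i)}})"
    by (auto simp: fat_wedge_def)
  moreover have "closedin ?P {x \<in> topspace ?P. x i \<in> {pbase (X i)}}" if "i \<in> I" for i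
    using assms that unfolding closed_pairs_def
    by (intro closedin_continuous_map_preimage[OF continuous_map_pointed_projection]) auto
  ultimately show "closedin ?P (fat_wedge I X)"
    using assms by (auto simp: closed_pairs_def intro!: closedin_Union)
qed

lemma closedin_poly_blocks:
  assumes "closed_pairs I X A" "finite K"
  shows "closedin (kification (product_topology (\<lambda>i. ptop (X i)) I)) (poly_blocks I K X A)"
  unfolding poly_blocks_def
proof (intro closedin_kification_finer closedin_Union)
  fix S assume "S \<in> (\<lambda>\<sigma>. PiE I (\<lambda>i. if i \<in> \<sigma> then points (X i) else A i)) ` K"
  then show "closedin (product_topology (\<lambda>i. ptop (X i)) I) S"
    using assms(1) by (auto simp: closedin_product_topology closed_pairs_def)
qed (use assms(2) in auto)

lemma topspace_poly_space:
  assumes "closed_pairs I X A"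
  shows "topspace (poly_space I K X A) = fat_wedge I X \<union> poly_blocks I K X A"
  using fat_wedge_subset[of I X] poly_blocks_subset[OF assms, of K]
  by (auto simp: poly_space_def)

lemma k_space_poly_space:
  assumes "closed_pairs I X A" "finite K"
  shows "k_space (poly_space I K X A)"
  unfolding poly_space_def
  by (intro k_space_closed_subtopology k_space_kification closedin_Un
      closedin_fat_wedge[OF assms(1)] closedin_poly_blocks assms)

text \<open>\<open>D\<close> is closed and contains \<open>A\<close>, so it is the full preimage of
  its image with the base point added, and that image is closed. On both sides a subset of it is
  therefore closed iff its preimage is closed in \<open>X\<close>.\<close>

lemma subtopology_collapse:
  assumes "closedin X D" "A \<subseteq> D"
  shows "subtopology (ptop (collapse X A)) (insert A (collapse_map A ` D)) =
    ptop (collapse (subtopology X D) A)"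
proof -
  let ?S = "insert A (collapse_map A ` D)"
  have D: "D \<subseteq> topspace X"
    using assms(1) by (rule closedin_subset)
  have pre: "{x \<in> topspace X. collapse_map A x \<in> ?S} = D"
    using D assms(2) by (auto simp: collapse_map_def split: if_splits)
  have S: "closedin (ptop (collapse X A)) ?S"
    unfolding closedin_collapse pre using assms(1) D by (auto simp: points_collapse)
  have pts: "points (collapse (subtopology X D) A) = ?S"
    using D by (auto simp: points_collapse)
  have eq: "{x \<in> topspace X. collapse_map A x \<in> T} = {x \<in> topspace (subtopology X D). collapse_map A x \<in> T}"
    if "T \<subseteq> ?S" for T
  proof -
    have "x \<in> {x \<in> topspace X. collapse_map A x \<in> ?S}"
      if "x \<in> topspace X" "collapse_map A x \<in> T" for x
      using that \<open>T \<subseteq> ?S\<close> by blast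
    then have "x \<in> D" if "x \<in> topspace X" "collapse_map A x \<in> T" for x
      unfolding pre using that by blast
    then show ?thesis
      using D by auto
  qed
  have "closedin (subtopology (ptop (collapse X A)) ?S) T \<longleftrightarrow>
      closedin (ptop (collapse (subtopology X D) A)) T" for T
  proof (cases "T \<subseteq> ?S")
    case True
    have "closedin (subtopology (ptop (collapse X A)) ?S) T \<longleftrightarrow> closedin (ptop (collapse X A)) T"
      using True S by (simp add: closedin_closed_subtopology)
    also have "\<dots> \<longleftrightarrow> closedin X {x \<in> topspace (subtopology X D). collapse_map A x \<in> T}"
      unfolding closedin_collapse eq[OF True]
      using True closedin_subset[OF S] by blast
    also have "\<dots> \<longleftrightarrow> closedin (subtopology X D) {x \<in> topspace (subtopology X D). collapse_map A x \<in> T}"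
      using assms(1) by (subst closedin_closed_subtopology) auto
    also have "\<dots> \<longleftrightarrow> closedin (ptop (collapse (subtopology X D) A)) T"
      unfolding closedin_collapse pts using True by blast
    finally show ?thesis .
  next
    case False
    then show ?thesis
      using closedin_subset[of _ T] pts by (metis closedin_collapse closedin_subtopology inf_le2)
  qed
  then have "closedin (subtopology (ptop (collapse X A)) ?S) = closedin (ptop (collapse (subtopology X D) A))"
    by blast
  moreover from this have "topspace (subtopology (ptop (collapse X A)) ?S) = points (collapse (subtopology X D) A)"
    by (metis closedin_subset closedin_topspace subset_antisym)
  ultimately show ?thesis
    by (simp add: topology_eq openin_closedin_eq)
qed

text \<open>Adding the fat wedge to the blocks contributes only the base point, which every
  \<open>smash_block\<close> already contains.\<close>

lemma smash_blocks_eq: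
  assumes "K \<noteq> {}"
  shows "(\<Union>\<sigma>\<in>K. smash_block I X A \<sigma>) =
    insert (fat_wedge I X) (collapse_map (fat_wedge I X) ` (fat_wedge I X \<union> poly_blocks I K X A))"
proof -
  have "collapse_map (fat_wedge I X) ` fat_wedge I X \<subseteq> {fat_wedge I X}"
    by (auto simp: collapse_map_def)
  moreover have "(\<Union>\<sigma>\<in>K. smash_block I X A \<sigma>) =
      insert (fat_wedge I X) (collapse_map (fat_wedge I X) ` poly_blocks I K X A)"
    using assms unfolding smash_block_def poly_blocks_def by blast
  ultimately show ?thesis
    unfolding image_Un by (simp add: insert_absorb subset_singleton_iff) (elim disjE; simp)
qed

text \<open>The definition collapses first, then restricts, then applies \<open>kification\<close>.
  Here the order becomes restrict, then collapse; a closed subspace of a k-space and its collapse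
  are k-spaces, so the last \<open>kification\<close> changes nothing.\<close>

lemma polyhedral_smash_eq_collapse:
  assumes X: "closed_pairs I X A" and K: "finite K" "K \<noteq> {}"
  shows "polyhedral_smash I K X A = collapse (poly_space I K X A) (fat_wedge I X)"
proof -
  have "subtopology (ptop (big_smash I X)) (\<Union>\<sigma>\<in>K. smash_block I X A \<sigma>) =
      ptop (collapse (poly_space I K X A) (fat_wedge I X))"
    unfolding big_smash_def smash_blocks_eq[OF K(2)] poly_space_def
    by (intro subtopology_collapse closedin_Un closedin_fat_wedge[OF X] closedin_poly_blocks X K) auto
  moreover have "kification (ptop (collapse (poly_space I K X A) (fat_wedge I X))) =
      ptop (collapse (poly_space I K X A) (fat_wedge I X))"
    unfolding kification_eq_self by (intro k_space_collapse k_space_poly_space X K)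
  ultimately show ?thesis
    by (simp add: polyhedral_smash_def big_smash_def)
qed

lemma polyhedral_smash_full:
  assumes "K \<noteq> {}"
  shows "polyhedral_smash I K X (\<lambda>j. points (X j)) = big_smash I X"
proof -
  have "poly_blocks I K X (\<lambda>j. points (X j)) = PiE I (\<lambda>i. points (X i))"
    using assms by (auto simp: poly_blocks_def)
  then have "(\<Union>\<sigma>\<in>K. smash_block I X (\<lambda>j. points (X j)) \<sigma>) = points (big_smash I X)"
    using fat_wedge_subset[of I X]
    by (simp add: smash_blocks_eq[OF assms] big_smash_def points_collapse Un_absorb1)
  moreover have "kification (ptop (big_smash I X)) = ptop (big_smash I X)"
    unfolding kification_eq_self big_smash_def by (intro k_space_collapse k_space_kification)
  ultimately show ?thesis
    by (simp add: polyhedral_smash_def)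
qed

section \<open>Smash products of Hausdorff spaces\<close>

lemma Hausdorff_space_kification:
  assumes "Hausdorff_space X"
  shows "Hausdorff_space (kification X)"
  unfolding Hausdorff_space_def topspace_kification
proof (intro allI impI)
  fix x y assume "x \<in> topspace X \<and> y \<in> topspace X \<and> x \<noteq> y"
  then obtain U V where UV: "openin X U" "openin X V" "x \<in> U" "y \<in> V" "disjnt U V"
    using assms[unfolded Hausdorff_space_def, rule_format, of x y] by blast
  then show "\<exists>U V. openin (kification X) U \<and> openin (kification X) V \<and> x \<in> U \<and> y \<in> V \<and> disjnt U V"
    by (intro exI[of _ U] exI[of _ V]) (simp add: openin_kification_finer)
qed

lemma Hausdorff_space_big_smash:
  assumes I: "finite I" and X: "\<And>i. i \<in> I \<Longrightarrow> Hausdorff_space (ptop (X i))"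
    and base: "\<And>i. i \<in> I \<Longrightarrow> pbase (X i) \<in> points (X i)"
  shows "Hausdorff_space (ptop (big_smash I X))"
  unfolding big_smash_def
proof (rule Hausdorff_space_collapse)
  let ?P = "product_topology (\<lambda>i. ptop (X i)) I"
  show "Hausdorff_space (kification ?P)"
    by (intro Hausdorff_space_kification) (use X in \<open>simp add: Hausdorff_space_product_topology\<close>)
  show "closedin (kification ?P) (fat_wedge I X)"
    by (rule closedin_fat_wedge[of _ _ "\<lambda>i. points (X i)"])
      (use assms in \<open>auto simp: closed_pairs_def closedin_Hausdorff_singleton\<close>)
  fix x assume "x \<in> topspace (kification ?P) - fat_wedge I X"
  then have x: "x \<in> PiE I (\<lambda>i. points (X i))" "\<And>i. i \<in> I \<Longrightarrow> x i \<noteq> pbase (X i)"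
    by (auto simp: fat_wedge_def)
  have "\<exists>U V. openin (ptop (X i)) U \<and> openin (ptop (X i)) V \<and> x i \<in> U \<and> pbase (X i) \<in> V \<and> disjnt U V"
    if i: "i \<in> I" for i
  proof -
    have "x i \<in> points (X i)"
      using x(1) i by blast
    then show ?thesis
      using X[OF i, unfolded Hausdorff_space_def, rule_format, of "x i" "pbase (X i)"] base[OF i] x(2)[OF i]
      by blast
  qed
  then obtain U V where UV: "\<And>i. i \<in> I \<Longrightarrow> openin (ptop (X i)) (U i) \<and> openin (ptop (X i)) (V i) \<and>
      x i \<in> U i \<and> pbase (X i) \<in> V i \<and> disjnt (U i) (V i)"
    by metis
  \<comment> \<open>The box of the \<open>U i\<close> consists of points with every coordinate away
    from its base point; a point of the fat wedge has some coordinate at its base point and so lies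
    in one of these slabs. Finiteness of \<open>I\<close> makes the box open.\<close>
  let ?V = "\<Union>i\<in>I. {y \<in> topspace ?P. y i \<in> V i}"
  have "openin ?P {y \<in> topspace ?P. y i \<in> V i}" if "i \<in> I" for i
    using UV that by (intro openin_continuous_map_preimage[OF continuous_map_pointed_projection]) auto
  then have "openin ?P ?V"
    by (intro openin_Union) auto
  moreover have "openin ?P (PiE I U)"
    using UV I by (simp add: openin_PiE)
  moreover have "x \<in> PiE I U"
    using x(1) UV by (auto simp: PiE_def)
  moreover have "fat_wedge I X \<subseteq> ?V"
    using UV by (auto simp: fat_wedge_def)
  moreover have "disjnt (PiE I U) ?V"
  proof -
    have "y i \<notin> V i" if "y \<in> PiE I U" "i \<in> I" for y i
      using that UV[of i] by (auto simp: disjnt_iff PiE_iff)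
    then show ?thesis by (auto simp: disjnt_iff)
  qed
  ultimately show "\<exists>U V. openin (kification ?P) U \<and> openin (kification ?P) V \<and> x \<in> U \<and>
      fat_wedge I X \<subseteq> V \<and> disjnt U V"
    by (intro exI[of _ "PiE I U"] exI[of _ ?V]) (simp only: openin_kification_finer simp_thms)
qed

section \<open>The decomposition map\<close>

definition c_factor ::
    "nat set set \<Rightarrow> (nat \<Rightarrow> 'c pointed) \<Rightarrow> (nat \<Rightarrow> 'c set) \<Rightarrow> nat set \<Rightarrow> (nat \<Rightarrow> 'c) set pointed" where
  "c_factor K C E I = polyhedral_smash I (full_subcomplex K I) C E"

definition b_factor ::
    "nat \<Rightarrow> nat set set \<Rightarrow> (nat \<Rightarrow> 'b pointed) \<Rightarrow> nat set \<Rightarrow> (nat \<Rightarrow> 'b) set pointed" where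
  "b_factor m K B I =
     polyhedral_smash ({1..m} - I) (full_subcomplex K ({1..m} - I)) B (\<lambda>j. points (B j))"

lemma decomp_summand_eq: "decomp_summand m K B C E I = smash (c_factor K C E I) (b_factor m K B I)"
  by (simp add: decomp_summand_def c_factor_def b_factor_def)

abbreviation summand_base ::
    "nat \<Rightarrow> nat set set \<Rightarrow> (nat \<Rightarrow> 'b pointed) \<Rightarrow> (nat \<Rightarrow> 'c pointed) \<Rightarrow> (nat \<Rightarrow> 'c set) \<Rightarrow>
     nat set \<Rightarrow> ((nat \<Rightarrow> 'c) set \<times> (nat \<Rightarrow> 'b) set) set" where
  "summand_base m K B C E I \<equiv> smash_base (c_factor K C E I) (b_factor m K B I)"

abbreviation target_base ::
    "nat \<Rightarrow> nat set set \<Rightarrow> (nat \<Rightarrow> 'b pointed) \<Rightarrow> (nat \<Rightarrow> 'c pointed) \<Rightarrow> (nat \<Rightarrow> 'c set) \<Rightarrow>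
     (nat set \<times> ((nat \<Rightarrow> 'c) set \<times> (nat \<Rightarrow> 'b) set) set) set" where
  "target_base m K B C E \<equiv> big_wedge_base (Pow {1..m}) (decomp_summand m K B C E)"

abbreviation source_base :: "nat \<Rightarrow> (nat \<Rightarrow> 'b pointed) \<Rightarrow> (nat \<Rightarrow> 'c pointed) \<Rightarrow> (nat \<Rightarrow> ('b + 'c) set) set" where
  "source_base m B C \<equiv> fat_wedge {1..m} (\<lambda>i. wedge (B i) (C i))"

definition summand_point ::
    "nat \<Rightarrow> nat set set \<Rightarrow> (nat \<Rightarrow> 'b pointed) \<Rightarrow> (nat \<Rightarrow> 'c pointed) \<Rightarrow> (nat \<Rightarrow> 'c set) \<Rightarrow>
     nat set \<Rightarrow> (nat \<Rightarrow> 'c) \<Rightarrow> (nat \<Rightarrow> 'b) \<Rightarrow> ((nat \<Rightarrow> 'c) set \<times> (nat \<Rightarrow> 'b) set) set" where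
  "summand_point m K B C E I c b =
     collapse_map (summand_base m K B C E I)
       (collapse_map (fat_wedge I C) c, collapse_map (fat_wedge ({1..m} - I) B) b)"

definition target_point ::
    "nat \<Rightarrow> nat set set \<Rightarrow> (nat \<Rightarrow> 'b pointed) \<Rightarrow> (nat \<Rightarrow> 'c pointed) \<Rightarrow> (nat \<Rightarrow> 'c set) \<Rightarrow>
     nat set \<Rightarrow> (nat \<Rightarrow> 'c) \<Rightarrow> (nat \<Rightarrow> 'b) \<Rightarrow>
     (nat set \<times> ((nat \<Rightarrow> 'c) set \<times> (nat \<Rightarrow> 'b) set) set) set" where
  "target_point m K B C E I c b = collapse_map (target_base m K B C E) (I, summand_point m K B C E I c b)"

text \<open>A coordinate at the base point, which belongs to both summands, is counted with
  \<open>B\<close>.\<close>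

definition right_indices :: "nat \<Rightarrow> (nat \<Rightarrow> 'b pointed) \<Rightarrow> (nat \<Rightarrow> 'c pointed) \<Rightarrow> (nat \<Rightarrow> ('b + 'c) set) \<Rightarrow> nat set" where
  "right_indices m B C u = {i \<in> {1..m}. wedge_snd (B i) (C i) (u i) \<noteq> pbase (C i)}"

text \<open>With \<open>I\<close> fixed, the formula is continuous on all source blocks. It gives
  the value of the decomposition map on points with coordinates in \<open>C\<^sub>i\<close> for
  \<open>i \<in> I\<close> and in \<open>B\<^sub>j\<close> for the other indices.\<close>

definition pinch ::
    "nat \<Rightarrow> nat set set \<Rightarrow> (nat \<Rightarrow> 'b pointed) \<Rightarrow> (nat \<Rightarrow> 'c pointed) \<Rightarrow> (nat \<Rightarrow> 'c set) \<Rightarrow>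
     nat set \<Rightarrow> (nat \<Rightarrow> ('b + 'c) set) \<Rightarrow> (nat set \<times> ((nat \<Rightarrow> 'c) set \<times> (nat \<Rightarrow> 'b) set) set) set" where
  "pinch m K B C E I u = target_point m K B C E I
     (\<lambda>i\<in>I. wedge_snd (B i) (C i) (u i)) (\<lambda>j\<in>{1..m} - I. wedge_fst (B j) (C j) (u j))"

definition decomp_map :: "nat \<Rightarrow> nat set set \<Rightarrow> ('b, 'c) decomp_transformation" where
  "decomp_map m K B C E = collapse_lift (source_base m B C) (target_base m K B C E)
     (\<lambda>u. pinch m K B C E (right_indices m B C u) u)"

definition glue ::
    "nat \<Rightarrow> (nat \<Rightarrow> 'b pointed) \<Rightarrow> (nat \<Rightarrow> 'c pointed) \<Rightarrow> nat set \<Rightarrow> (nat \<Rightarrow> 'c) \<Rightarrow> (nat \<Rightarrow> 'b) \<Rightarrow>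
     nat \<Rightarrow> ('b + 'c) set" where
  "glue m B C I c b =
     (\<lambda>i\<in>{1..m}. if i \<in> I then wedge_inr (B i) (C i) (c i) else wedge_inl (B i) (C i) (b i))"

text \<open>Two nested lifts, because the domain is a product of two collapses. A base point in
  either factor is sent to the base point of the source.\<close>

definition factor_inverse where
  "factor_inverse m B C I = (\<lambda>(x, y).
     collapse_lift (fat_wedge I C) (source_base m B C)
       (\<lambda>c. collapse_lift (fat_wedge ({1..m} - I) B) (source_base m B C)
         (\<lambda>b. collapse_map (source_base m B C) (glue m B C I c b)) y) x)"

definition decomp_inverse where
  "decomp_inverse m K B C E = collapse_lift (target_base m K B C E) (source_base m B C)
     (\<lambda>(I, s). collapse_lift (summand_base m K B C E I) (source_base m B C) (factor_inverse m B C I) s)"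

locale wedge_decomposition =
  fixes m :: nat and K :: "nat set set"
    and B :: "nat \<Rightarrow> 'b pointed" and C :: "nat \<Rightarrow> 'c pointed" and E :: "nat \<Rightarrow> 'c set"
  assumes complex: "simplicial_complex_on {1..m} K" and decomposable: "wedge_decomposable m B C E"
begin

text \<open>Keeps the simplifier from rewriting the index set \<open>{1..m}\<close> to
  \<open>{Suc 0..m}\<close>.\<close>

declare One_nat_def [simp del]

abbreviation U :: "nat \<Rightarrow> ('b + 'c) set pointed" where
  "U \<equiv> \<lambda>i. wedge (B i) (C i)"

abbreviation V :: "nat \<Rightarrow> ('b + 'c) set set" where
  "V \<equiv> \<lambda>i. wedge_subset (B i) (C i) (points (B i)) (E i)"

abbreviation source_blocks :: "(nat \<Rightarrow> ('b + 'c) set) set" where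
  "source_blocks \<equiv> poly_blocks {1..m} K U V"

abbreviation c_blocks :: "nat set \<Rightarrow> (nat \<Rightarrow> 'c) set" where
  "c_blocks I \<equiv> poly_blocks I (full_subcomplex K I) C E"

abbreviation b_box :: "nat set \<Rightarrow> (nat \<Rightarrow> 'b) set" where
  "b_box I \<equiv> PiE ({1..m} - I) (\<lambda>j. points (B j))"

lemma B_facts:
  assumes "i \<in> {1..m}"
  shows "Hausdorff_space (ptop (B i))" "pbase (B i) \<in> points (B i)"
  using decomposable assms pointed_CW_pairD[of "B i" "points (B i)"]
  by (auto simp: wedge_decomposable_def pointed_CW_complex_def)

lemma C_facts:
  assumes "i \<in> {1..m}"
  shows "Hausdorff_space (ptop (C i))" "pbase (C i) \<in> points (C i)" "pbase (C i) \<in> E i"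
    "closedin (ptop (C i)) (E i)"
  using decomposable assms pointed_CW_pairD[of "C i" "E i"] by (auto simp: wedge_decomposable_def)

lemma finite_complex: "finite K" "K \<noteq> {}"
  using complex finite_subset[of K "Pow {1..m}"] by (auto simp: simplicial_complex_on_def)

lemma finite_full_subcomplex: "finite (full_subcomplex K I)" "full_subcomplex K I \<noteq> {}"
  using complex finite_complex by (auto simp: full_subcomplex_def simplicial_complex_on_def)

lemma closed_pairs_C:
  assumes "I \<subseteq> {1..m}"
  shows "closed_pairs I C E"
  unfolding closed_pairs_def
proof (intro conjI ballI)
  show "finite I"
    using assms by (rule finite_subset) simp
  fix i assume "i \<in> I"
  then have i: "i \<in> {1..m}"
    using assms by blast
  show "closedin (ptop (C i)) {pbase (C i)}" "closedin (ptop (C i)) (E i)"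
    using C_facts[OF i] by (simp_all add: closedin_Hausdorff_singleton)
qed

lemma closed_pairs_U: "closed_pairs {1..m} U V"
  unfolding closed_pairs_def
proof (intro conjI ballI)
  fix i assume i: "i \<in> {1..m}"
  note b = B_facts[OF i] and c = C_facts[OF i]
  have "closedin (ptop (U i)) (wedge_subset (B i) (C i) {pbase (B i)} {pbase (C i)})"
    using b c by (intro closedin_wedge_subset) (auto simp: closedin_Hausdorff_singleton)
  moreover have "wedge_subset (B i) (C i) {pbase (B i)} {pbase (C i)} = {pbase (U i)}"
    by (simp add: wedge_subset_eq)
  ultimately show "closedin (ptop (U i)) {pbase (U i)}"
    by simp
  show "closedin (ptop (U i)) (V i)"
    using b c by (intro closedin_wedge_subset) auto
qed simp

lemma source_eq: "decomp_source m K B C E = collapse (poly_space {1..m} K U V) (source_base m B C)"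
  unfolding decomp_source_def
  by (rule polyhedral_smash_eq_collapse[OF closed_pairs_U finite_complex])

lemma c_factor_eq:
  assumes "I \<subseteq> {1..m}"
  shows "c_factor K C E I = collapse (poly_space I (full_subcomplex K I) C E) (fat_wedge I C)"
  unfolding c_factor_def
  by (rule polyhedral_smash_eq_collapse[OF closed_pairs_C[OF assms] finite_full_subcomplex])

lemma b_factor_eq: "b_factor m K B I =
    collapse (kification (product_topology (\<lambda>j. ptop (B j)) ({1..m} - I))) (fat_wedge ({1..m} - I) B)"
  unfolding b_factor_def polyhedral_smash_full[OF finite_full_subcomplex(2)] big_smash_def ..

lemma points_source:
  "points (decomp_source m K B C E) =
    insert (source_base m B C) (collapse_map (source_base m B C) ` (source_base m B C \<union> source_blocks))"
  unfolding source_eq points_collapse topspace_poly_space[OF closed_pairs_U] ..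

lemma points_c_factor:
  assumes "I \<subseteq> {1..m}"
  shows "points (c_factor K C E I) =
    insert (fat_wedge I C) (collapse_map (fat_wedge I C) ` (fat_wedge I C \<union> c_blocks I))"
  unfolding c_factor_eq[OF assms] points_collapse topspace_poly_space[OF closed_pairs_C[OF assms]] ..

lemma points_b_factor:
  "points (b_factor m K B I) =
    insert (fat_wedge ({1..m} - I) B) (collapse_map (fat_wedge ({1..m} - I) B) ` b_box I)"
  unfolding b_factor_eq points_collapse by simp

lemma pbase_c_factor: "I \<subseteq> {1..m} \<Longrightarrow> pbase (c_factor K C E I) = fat_wedge I C"
  by (simp add: c_factor_eq)

lemma pbase_b_factor: "pbase (b_factor m K B I) = fat_wedge ({1..m} - I) B"
  by (simp add: b_factor_eq)

lemma pbase_summand: "pbase (decomp_summand m K B C E I) = summand_base m K B C E I"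
  by (simp add: decomp_summand_eq smash_def)

lemma pbase_source: "pbase (decomp_source m K B C E) = source_base m B C"
  by (simp add: source_eq)

lemma pbase_target: "pbase (decomp_target m K B C E) = target_base m K B C E"
  by (simp add: decomp_target_def big_wedge_def)

lemma source_points_wedge:
  assumes "u \<in> source_base m B C \<union> source_blocks" "i \<in> {1..m}"
  shows "u i \<in> wedge_inl (B i) (C i) ` points (B i) \<union> wedge_inr (B i) (C i) ` points (C i)"
proof -
  have "u \<in> PiE {1..m} (\<lambda>i. points (U i))"
    using assms(1) fat_wedge_subset poly_blocks_subset[OF closed_pairs_U] by blast
  then have "u i \<in> points (U i)"
    using assms(2) by (rule PiE_mem)
  then show ?thesis
    using B_facts(2)[OF assms(2)] by (simp add: points_wedge)
qed

section \<open>The bijection on points\<close>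

lemma glue_mem_source_base_iff:
  assumes "I \<subseteq> {1..m}" "c \<in> fat_wedge I C \<union> c_blocks I" "b \<in> b_box I"
  shows "glue m B C I c b \<in> source_base m B C \<longleftrightarrow> c \<in> fat_wedge I C \<or> b \<in> fat_wedge ({1..m} - I) B"
proof -
  have c: "c \<in> PiE I (\<lambda>i. points (C i))"
    using assms(2) fat_wedge_subset poly_blocks_subset[OF closed_pairs_C[OF assms(1)]] by blast
  have "glue m B C I c b i \<in> points (U i)" if "i \<in> {1..m}" for i
    using that c assms(3) B_facts(2)[OF that] by (auto simp: glue_def points_wedge)
  then have "glue m B C I c b \<in> PiE {1..m} (\<lambda>i. points (U i))"
    by (auto simp: glue_def)
  then have "glue m B C I c b \<in> source_base m B C \<longleftrightarrow> (\<exists>i\<in>{1..m}. glue m B C I c b i = wedge_base (B i) (C i))"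
    by (simp add: fat_wedge_def)
  also have "\<dots> \<longleftrightarrow> (\<exists>i\<in>I. c i = pbase (C i)) \<or> (\<exists>j\<in>{1..m} - I. b j = pbase (B j))"
    using assms(1) by (auto simp: glue_def split: if_splits)
  also have "\<dots> \<longleftrightarrow> c \<in> fat_wedge I C \<or> b \<in> fat_wedge ({1..m} - I) B"
    using c assms(3) by (simp add: fat_wedge_def)
  finally show ?thesis .
qed

text \<open>The same \<sigma> serves in \<open>K\<close>: indices outside \<open>I\<close> are
  outside \<sigma>, and there the coordinate in \<open>B\<^sub>i\<close> is allowed since
  \<open>V i\<close> contains all of \<open>B\<^sub>i\<close>.\<close>

lemma glue_mem_blocks:
  assumes "I \<subseteq> {1..m}" "c \<in> c_blocks I" "b \<in> b_box I"
  shows "glue m B C I c b \<in> source_blocks"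
proof -
  obtain \<sigma> where \<sigma>: "\<sigma> \<in> K" "\<sigma> \<subseteq> I" "c \<in> PiE I (\<lambda>i. if i \<in> \<sigma> then points (C i) else E i)"
    using assms(2) by (auto simp: poly_blocks_def full_subcomplex_def)
  have "glue m B C I c b i \<in> (if i \<in> \<sigma> then points (U i) else V i)" if i: "i \<in> {1..m}" for i
  proof (cases "i \<in> I")
    case True
    then have "c i \<in> (if i \<in> \<sigma> then points (C i) else E i)"
      using \<sigma>(3) PiE_mem by fast
    then show ?thesis
      using True i B_facts(2)[OF i] by (auto simp: glue_def points_wedge wedge_subset_eq)
  next
    case False
    then have "b i \<in> points (B i)" "i \<notin> \<sigma>"
      using assms(3) i \<sigma>(2) by auto
    then show ?thesis
      using False i by (auto simp: glue_def wedge_subset_eq)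
  qed
  then have "glue m B C I c b \<in> PiE {1..m} (\<lambda>i. if i \<in> \<sigma> then points (U i) else V i)"
    by (intro PiE_I) (auto simp: glue_def)
  then show ?thesis
    using \<sigma>(1) unfolding poly_blocks_def by blast
qed

lemma glue_mem_source:
  assumes "I \<subseteq> {1..m}" "c \<in> fat_wedge I C \<union> c_blocks I" "b \<in> b_box I"
  shows "glue m B C I c b \<in> source_base m B C \<union> source_blocks"
  using assms glue_mem_source_base_iff[OF assms] glue_mem_blocks by blast

text \<open>The simplex is \<open>\<sigma> \<inter> I\<close>. Pinching sends \<open>V i\<close>
  into \<open>E i\<close> because the base point lies in \<open>E i\<close>.\<close>

lemma wedge_snd_mem_c_blocks:
  assumes "I \<subseteq> {1..m}" "u \<in> source_blocks"
  shows "(\<lambda>i\<in>I. wedge_snd (B i) (C i) (u i)) \<in> c_blocks I"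
proof -
  obtain \<sigma> where \<sigma>: "\<sigma> \<in> K" "u \<in> PiE {1..m} (\<lambda>i. if i \<in> \<sigma> then points (U i) else V i)"
    using assms(2) by (auto simp: poly_blocks_def)
  have "wedge_snd (B i) (C i) (u i) \<in> (if i \<in> \<sigma> \<inter> I then points (C i) else E i)" if "i \<in> I" for i
  proof -
    have i: "i \<in> {1..m}"
      using that assms(1) by blast
    have "u i \<in> (if i \<in> \<sigma> then points (U i) else V i)"
      using \<sigma>(2) i PiE_mem by fast
    then show ?thesis
      using that B_facts(2)[OF i] C_facts(2,3)[OF i]
      by (auto simp: points_wedge wedge_subset_eq split: if_splits)
  qed
  then have "(\<lambda>i\<in>I. wedge_snd (B i) (C i) (u i)) \<in> PiE I (\<lambda>i. if i \<in> \<sigma> \<inter> I then points (C i) else E i)"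
    by (simp add: restrict_PiE_iff)
  moreover have "\<sigma> \<inter> I \<in> full_subcomplex K I"
    using \<sigma>(1) complex by (auto simp: full_subcomplex_def simplicial_complex_on_def)
  ultimately show ?thesis
    unfolding poly_blocks_def by blast
qed

lemma wedge_fst_mem_b_box:
  assumes "u \<in> source_base m B C \<union> source_blocks"
  shows "(\<lambda>j\<in>{1..m} - I. wedge_fst (B j) (C j) (u j)) \<in> b_box I"
proof -
  have "wedge_fst (B j) (C j) (u j) \<in> points (B j)" if "j \<in> {1..m} - I" for j
    using that source_points_wedge[OF assms, of j] B_facts(2)[of j] by auto
  then show ?thesis
    by (simp add: restrict_PiE_iff)
qed

lemma summand_point_base:
  assumes "I \<subseteq> {1..m}" "c \<in> fat_wedge I C \<union> c_blocks I" "b \<in> b_box I"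
    and "c \<in> fat_wedge I C \<or> b \<in> fat_wedge ({1..m} - I) B"
  shows "summand_point m K B C E I c b = summand_base m K B C E I"
proof -
  have "(collapse_map (fat_wedge I C) c, collapse_map (fat_wedge ({1..m} - I) B) b) \<in> summand_base m K B C E I"
    using assms(2-4) unfolding smash_base_def points_c_factor[OF assms(1)] points_b_factor
      pbase_c_factor[OF assms(1)] pbase_b_factor by (auto simp: collapse_map_def)
  then show ?thesis
    by (simp add: summand_point_def collapse_map_def)
qed

lemma pair_mem_target_base: "I \<subseteq> {1..m} \<Longrightarrow> (I, s) \<in> target_base m K B C E \<longleftrightarrow> s = summand_base m K B C E I"
  by (auto simp: big_wedge_base_def pbase_summand)

lemma target_point_base:
  assumes "I \<subseteq> {1..m}" "c \<in> fat_wedge I C \<union> c_blocks I" "b \<in> b_box I"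
    and "c \<in> fat_wedge I C \<or> b \<in> fat_wedge ({1..m} - I) B"
  shows "target_point m K B C E I c b = target_base m K B C E"
  using assms(1) by (simp add: target_point_def summand_point_base[OF assms] collapse_map_def pair_mem_target_base)

text \<open>If some coordinate of \<open>c\<close> or \<open>b\<close> is a base point, both sides
  are base points; naturality relies on this case. Otherwise \<open>right_indices\<close> recovers
  \<open>I\<close>, and pinching recovers \<open>c\<close> and \<open>b\<close>.\<close>

lemma decomp_map_glue:
  assumes "I \<subseteq> {1..m}" "c \<in> fat_wedge I C \<union> c_blocks I" "b \<in> b_box I"
  shows "decomp_map m K B C E (collapse_map (source_base m B C) (glue m B C I c b)) = target_point m K B C E I c b"
proof (cases "c \<in> fat_wedge I C \<or> b \<in> fat_wedge ({1..m} - I) B")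
  case True
  then show ?thesis
    using glue_mem_source_base_iff[OF assms]
    by (simp add: decomp_map_def collapse_lift_collapse_map target_point_base[OF assms])
next
  case False
  have c: "c \<in> PiE I (\<lambda>i. points (C i))"
    using assms(2) fat_wedge_subset poly_blocks_subset[OF closed_pairs_C[OF assms(1)]] by blast
  have "c i \<noteq> pbase (C i)" if "i \<in> I" for i
    using False c that by (auto simp: fat_wedge_def)
  then have I: "right_indices m B C (glue m B C I c b) = I"
    using assms(1) by (auto simp: right_indices_def glue_def split: if_splits)
  have "(\<lambda>i\<in>I. wedge_snd (B i) (C i) (glue m B C I c b i)) = c"
    using c assms(1) by (auto simp: glue_def fun_eq_iff PiE_def extensional_def)
  moreover have "(\<lambda>j\<in>{1..m} - I. wedge_fst (B j) (C j) (glue m B C I c b j)) = b"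
    using assms(3) by (auto simp: glue_def fun_eq_iff PiE_def extensional_def)
  ultimately have "pinch m K B C E I (glue m B C I c b) = target_point m K B C E I c b"
    by (simp add: pinch_def)
  then show ?thesis
    using False I glue_mem_source_base_iff[OF assms]
    by (simp add: decomp_map_def collapse_lift_collapse_map)
qed

text \<open>A normal form that reduces the inverse law and naturality to computations with
  \<open>glue\<close>. The index set is \<open>right_indices\<close> of a representative, and the
  two tuples are its pinched coordinates.\<close>

lemma source_point_cases:
  assumes "p \<in> points (decomp_source m K B C E)"
  obtains "p = source_base m B C"
  | I c b where "I \<subseteq> {1..m}" "c \<in> c_blocks I" "c \<notin> fat_wedge I C"
      "b \<in> b_box I" "b \<notin> fat_wedge ({1..m} - I) B"
      "p = collapse_map (source_base m B C) (glue m B C I c b)"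
proof (cases "p = source_base m B C")
  case False
  then obtain u where u: "u \<in> source_blocks" "u \<notin> source_base m B C" "p = collapse_map (source_base m B C) u"
    using assms by (auto simp: points_source collapse_map_def split: if_splits)
  define I where "I = right_indices m B C u"
  let ?c = "\<lambda>i\<in>I. wedge_snd (B i) (C i) (u i)"
  let ?b = "\<lambda>j\<in>{1..m} - I. wedge_fst (B j) (C j) (u j)"
  have I: "I \<subseteq> {1..m}"
    by (auto simp: I_def right_indices_def)
  have c: "?c \<in> c_blocks I"
    by (rule wedge_snd_mem_c_blocks[OF I u(1)])
  have b: "?b \<in> b_box I"
    using u(1) by (intro wedge_fst_mem_b_box) blast
  have "glue m B C I ?c ?b i = u i" if i: "i \<in> {1..m}" for i
  proof -
    have mem: "i \<in> I \<longleftrightarrow> wedge_snd (B i) (C i) (u i) \<noteq> pbase (C i)"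
      using i by (simp add: I_def right_indices_def)
    have "u i \<in> wedge_inl (B i) (C i) ` points (B i) \<union> wedge_inr (B i) (C i) ` points (C i)"
      using u(1) i by (intro source_points_wedge) simp_all
    then consider x where "u i = wedge_inl (B i) (C i) x" | y where "u i = wedge_inr (B i) (C i) y"
      by blast
    then show ?thesis
    proof cases
      case 1
      then show ?thesis
        using i mem by (simp add: glue_def)
    next
      case (2 y)
      show ?thesis
      proof (cases "y = pbase (C i)")
        case True
        then have "u i = wedge_base (B i) (C i)"
          using 2 by simp
        moreover have "wedge_inl (B i) (C i) (pbase (B i)) = wedge_base (B i) (C i)"
          by simp
        ultimately show ?thesis
          using i mem by (simp add: glue_def)
      next
        case False
        then show ?thesis
          using i mem 2 by (simp add: glue_def)
      qed
    qed
  qed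
  moreover have "u \<in> extensional {1..m}"
    using subsetD[OF poly_blocks_subset[OF closed_pairs_U] u(1)] by (simp add: PiE_def)
  ultimately have g: "glue m B C I ?c ?b = u"
    by (intro extensionalityI[of _ "{1..m}"]) (auto simp: glue_def)
  then have "?c \<notin> fat_wedge I C" "?b \<notin> fat_wedge ({1..m} - I) B"
    using u(2) glue_mem_source_base_iff[OF I _ b, of ?c] c by auto
  then show ?thesis
    using that(2)[OF I c _ b] g u(3) by simp
qed (rule that(1))

lemma decomp_inverse_target_point:
  assumes "I \<subseteq> {1..m}" "c \<in> fat_wedge I C \<union> c_blocks I" "b \<in> b_box I"
  shows "decomp_inverse m K B C E (target_point m K B C E I c b) = collapse_map (source_base m B C) (glue m B C I c b)"
proof (cases "c \<in> fat_wedge I C \<or> b \<in> fat_wedge ({1..m} - I) B")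
  case True
  then have "glue m B C I c b \<in> source_base m B C"
    using glue_mem_source_base_iff[OF assms] by blast
  then show ?thesis
    by (simp add: target_point_base[OF assms True] decomp_inverse_def) (simp add: collapse_map_def)
next
  case False
  let ?x = "collapse_map (fat_wedge I C) c" and ?y = "collapse_map (fat_wedge ({1..m} - I) B) b"
  have "?x \<noteq> fat_wedge I C" "?y \<noteq> fat_wedge ({1..m} - I) B"
    using False by (auto simp: collapse_map_def)
  then have xy: "(?x, ?y) \<notin> summand_base m K B C E I"
    by (simp add: smash_base_def pbase_c_factor[OF assms(1)] pbase_b_factor)
  \<comment> \<open>Outside \<open>summand_base\<close> the collapsed pair is a singleton containing
    a pair that \<open>summand_base\<close> does not contain.\<close>
  then have "summand_point m K B C E I c b \<noteq> summand_base m K B C E I"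
    unfolding summand_point_def collapse_map_def by (metis singletonI)
  then show ?thesis
    using False xy
    by (simp add: target_point_def decomp_inverse_def collapse_lift_collapse_map
        pair_mem_target_base[OF assms(1)] summand_point_def factor_inverse_def)
qed

lemma target_point_cases:
  assumes "t \<in> points (decomp_target m K B C E)"
  obtains "t = target_base m K B C E"
  | I c b where "I \<subseteq> {1..m}" "c \<in> fat_wedge I C \<union> c_blocks I" "b \<in> b_box I"
      "t = target_point m K B C E I c b"
proof (cases "t = target_base m K B C E")
  case False
  let ?T = "target_base m K B C E"
  obtain I s where I: "I \<subseteq> {1..m}" and s: "s \<in> points (decomp_summand m K B C E I)"
    and t: "t = collapse_map ?T (I, s)"
  proof -
    have "t \<in> collapse_map ?T ` topspace (sum_topology (\<lambda>I. ptop (decomp_summand m K B C E I)) (Pow {1..m}))"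
      using assms False unfolding decomp_target_def big_wedge_def points_collapse by blast
    then show ?thesis
      using that by (elim imageE) force
  qed
  have "s \<noteq> summand_base m K B C E I"
    using False t I by (auto simp: collapse_map_def pair_mem_target_base)
  then obtain x y where xy: "x \<in> points (c_factor K C E I)" "y \<in> points (b_factor m K B I)"
      "s = collapse_map (summand_base m K B C E I) (x, y)" "(x, y) \<notin> summand_base m K B C E I"
    using s by (auto simp: decomp_summand_eq smash_def points_collapse collapse_map_def)
  then have "x \<noteq> fat_wedge I C" "y \<noteq> fat_wedge ({1..m} - I) B"
    by (auto simp: smash_base_def pbase_c_factor[OF I] pbase_b_factor)
  then obtain c b where cb: "c \<in> fat_wedge I C \<union> c_blocks I" "x = collapse_map (fat_wedge I C) c"
      "b \<in> b_box I" "y = collapse_map (fat_wedge ({1..m} - I) B) b"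
    using xy(1,2) unfolding points_c_factor[OF I] points_b_factor by blast
  then have "t = target_point m K B C E I c b"
    using t xy(3) by (simp add: target_point_def summand_point_def)
  then show ?thesis
    using that(2)[OF I cb(1,3)] by blast
qed (rule that(1))

lemma decomp_inverse_decomp_map:
  assumes "p \<in> points (decomp_source m K B C E)"
  shows "decomp_inverse m K B C E (decomp_map m K B C E p) = p"
  using assms
proof (cases rule: source_point_cases)
  case 1
  then show ?thesis
    by (simp add: decomp_map_def decomp_inverse_def)
next
  case (2 I c b)
  then show ?thesis
    using decomp_map_glue[of I c b] decomp_inverse_target_point[of I c b] by simp
qed

lemma decomp_map_decomp_inverse:
  assumes "t \<in> points (decomp_target m K B C E)"
  shows "decomp_map m K B C E (decomp_inverse m K B C E t) = t"
  using assms
proof (cases rule: target_point_cases)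
  case 1
  then show ?thesis
    by (simp add: decomp_map_def decomp_inverse_def)
next
  case (2 I c b)
  then show ?thesis
    using decomp_map_glue[of I c b] decomp_inverse_target_point[of I c b] by simp
qed

section \<open>Continuity of the decomposition map\<close>

abbreviation source_product :: "(nat \<Rightarrow> ('b + 'c) set) topology" where
  "source_product \<equiv> kification (product_topology (\<lambda>i. ptop (U i)) {1..m})"

definition piece :: "nat set \<Rightarrow> (nat \<Rightarrow> ('b + 'c) set) set" where
  "piece I = PiE {1..m} (\<lambda>i. if i \<in> I then wedge_subset (B i) (C i) {pbase (B i)} (points (C i))
     else wedge_subset (B i) (C i) (points (B i)) {pbase (C i)})"

lemma closedin_piece: "closedin source_product (piece I)"
proof (rule closedin_kification_finer)
  have "closedin (ptop (U i)) (if i \<in> I then wedge_subset (B i) (C i) {pbase (B i)} (points (C i))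
     else wedge_subset (B i) (C i) (points (B i)) {pbase (C i)})" if "i \<in> {1..m}" for i
    using B_facts[OF that] C_facts[OF that]
    by (auto intro!: closedin_wedge_subset simp: closedin_Hausdorff_singleton)
  then show "closedin (product_topology (\<lambda>i. ptop (U i)) {1..m}) (piece I)"
    unfolding piece_def closedin_product_topology by blast
qed

lemma source_blocks_subset_pieces:
  assumes "u \<in> source_blocks"
  shows "u \<in> piece (right_indices m B C u)"
proof -
  have "u i \<in> (if i \<in> right_indices m B C u then wedge_subset (B i) (C i) {pbase (B i)} (points (C i))
     else wedge_subset (B i) (C i) (points (B i)) {pbase (C i)})" if i: "i \<in> {1..m}" for i
  proof -
    have mem: "i \<in> right_indices m B C u \<longleftrightarrow> wedge_snd (B i) (C i) (u i) \<noteq> pbase (C i)"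
      using i by (simp add: right_indices_def)
    have "u i \<in> wedge_inl (B i) (C i) ` points (B i) \<union> wedge_inr (B i) (C i) ` points (C i)"
      using assms i by (intro source_points_wedge) simp_all
    then consider x where "x \<in> points (B i)" "u i = wedge_inl (B i) (C i) x"
      | y where "y \<in> points (C i)" "u i = wedge_inr (B i) (C i) y"
      by blast
    then show ?thesis
    proof cases
      case 1
      then show ?thesis
        using mem by (simp add: wedge_subset_eq)
    next
      case 2
      then show ?thesis
        using mem by (simp add: wedge_subset_eq)
    qed
  qed
  moreover have "u \<in> extensional {1..m}"
    using subsetD[OF poly_blocks_subset[OF closed_pairs_U] assms] by (simp add: PiE_def)
  ultimately show ?thesis
    unfolding piece_def by (intro PiE_I) (auto simp: extensional_def)
qed

lemma glue_piece:
  assumes "u \<in> piece I"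
  shows "glue m B C I (\<lambda>i\<in>I. wedge_snd (B i) (C i) (u i)) (\<lambda>j\<in>{1..m} - I. wedge_fst (B j) (C j) (u j)) = u"
proof -
  have u: "u i \<in> (if i \<in> I then wedge_subset (B i) (C i) {pbase (B i)} (points (C i))
     else wedge_subset (B i) (C i) (points (B i)) {pbase (C i)})" if "i \<in> {1..m}" for i
    using assms that unfolding piece_def by (rule PiE_mem)
  have "u \<in> extensional {1..m}"
    using assms by (simp add: piece_def PiE_def)
  then show ?thesis
  proof (rule extensionalityI[rotated])
    fix i assume i: "i \<in> {1..m}"
    show "glue m B C I (\<lambda>i\<in>I. wedge_snd (B i) (C i) (u i)) (\<lambda>j\<in>{1..m} - I. wedge_fst (B j) (C j) (u j)) i = u i"
      using u[OF i] i by (cases "i \<in> I") (simp_all add: glue_def wedge_inr_snd wedge_inl_fst)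
  qed (simp add: glue_def)
qed

lemma continuous_map_source_coordinate:
  assumes "i \<in> {1..m}"
  shows "continuous_map source_product (ptop (U i)) (\<lambda>u. u i)"
  by (intro continuous_map_from_kification) (rule continuous_map_pointed_projection[OF assms])

text \<open>The domain excludes points that lie only in the fat wedge: their coordinates in
  \<open>I\<close> may form a tuple outside both \<open>c_blocks I\<close> and
  \<open>fat_wedge I C\<close>. The blocks form a k-space, so a map into a kified product is
  continuous as soon as its coordinates are.\<close>

lemma continuous_map_pinch:
  assumes I: "I \<subseteq> {1..m}"
  shows "continuous_map (subtopology source_product source_blocks) (ptop (decomp_target m K B C E)) (pinch m K B C E I)"
proof -
  let ?S = "subtopology source_product source_blocks"
  let ?c = "\<lambda>u. \<lambda>i\<in>I. wedge_snd (B i) (C i) (u i)"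
  let ?b = "\<lambda>u. \<lambda>j\<in>{1..m} - I. wedge_fst (B j) (C j) (u j)"
  have kS: "k_space ?S"
    by (intro k_space_closed_subtopology k_space_kification closedin_poly_blocks closed_pairs_U finite_complex)
  have coord: "continuous_map ?S (ptop (U i)) (\<lambda>u. u i)" if "i \<in> {1..m}" for i
    by (intro continuous_map_from_subtopology continuous_map_source_coordinate that)
  have top: "topspace ?S = source_blocks"
    using poly_blocks_subset[OF closed_pairs_U] by auto
  have "continuous_map ?S (ptop (C i)) (\<lambda>u. wedge_snd (B i) (C i) (u i))" if "i \<in> I" for i
  proof -
    have i: "i \<in> {1..m}"
      using that I by blast
    from continuous_map_compose[OF coord[OF i] continuous_map_wedge_snd[OF C_facts(2)[OF i]]]
    show ?thesis
      by (simp add: o_def)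
  qed
  then have "continuous_map ?S (product_topology (\<lambda>i. ptop (C i)) I) ?c"
    unfolding continuous_map_componentwise by auto
  then have "continuous_map ?S (poly_space I (full_subcomplex K I) C E) ?c"
    unfolding poly_space_def continuous_map_in_subtopology continuous_map_into_kification[OF kS] top
    using wedge_snd_mem_c_blocks[OF I] by blast
  from continuous_map_compose[OF this continuous_map_collapse_map]
  have c: "continuous_map ?S (ptop (c_factor K C E I)) (\<lambda>u. collapse_map (fat_wedge I C) (?c u))"
    by (simp add: c_factor_eq[OF I] o_def)
  have "continuous_map ?S (ptop (B j)) (\<lambda>u. wedge_fst (B j) (C j) (u j))" if "j \<in> {1..m} - I" for j
  proof -
    have j: "j \<in> {1..m}"
      using that by blast
    from continuous_map_compose[OF coord[OF j] continuous_map_wedge_fst[OF B_facts(2)[OF j]]]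
    show ?thesis
      by (simp add: o_def)
  qed
  then have "continuous_map ?S (product_topology (\<lambda>j. ptop (B j)) ({1..m} - I)) ?b"
    unfolding continuous_map_componentwise by auto
  then have "continuous_map ?S (kification (product_topology (\<lambda>j. ptop (B j)) ({1..m} - I))) ?b"
    unfolding continuous_map_into_kification[OF kS] .
  from continuous_map_compose[OF this continuous_map_collapse_map]
  have b: "continuous_map ?S (ptop (b_factor m K B I)) (\<lambda>u. collapse_map (fat_wedge ({1..m} - I) B) (?b u))"
    by (simp add: b_factor_eq o_def)
  have "continuous_map ?S (kification (prod_topology (ptop (c_factor K C E I)) (ptop (b_factor m K B I))))
      (\<lambda>u. (collapse_map (fat_wedge I C) (?c u), collapse_map (fat_wedge ({1..m} - I) B) (?b u)))"
    unfolding continuous_map_into_kification[OF kS] by (intro continuous_map_pairedI c b)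
  from continuous_map_compose[OF this continuous_map_collapse_map[of _ "summand_base m K B C E I"]]
  have s: "continuous_map ?S (ptop (decomp_summand m K B C E I)) (\<lambda>u. summand_point m K B C E I (?c u) (?b u))"
    by (simp add: decomp_summand_eq smash_def summand_point_def o_def)
  have "continuous_map ?S (sum_topology (\<lambda>I. ptop (decomp_summand m K B C E I)) (Pow {1..m}))
      (Pair I \<circ> (\<lambda>u. summand_point m K B C E I (?c u) (?b u)))"
    by (rule continuous_map_compose[OF s])
      (rule continuous_map_sum_topology_inclusion[where X = "\<lambda>I. ptop (decomp_summand m K B C E I)"], use I in simp)
  from continuous_map_compose[OF this continuous_map_collapse_map[of _ "target_base m K B C E"]]
  show ?thesis
    by (simp add: decomp_target_def big_wedge_def pinch_def[abs_def] target_point_def o_def)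
qed

lemma continuous_map_decomp_map:
  "continuous_map (ptop (decomp_source m K B C E)) (ptop (decomp_target m K B C E)) (decomp_map m K B C E)"
  unfolding source_eq
proof (rule continuous_map_from_collapse)
  have WB: "target_base m K B C E \<in> points (decomp_target m K B C E)"
    by (simp add: decomp_target_def big_wedge_def points_collapse)
  then show "decomp_map m K B C E (source_base m B C) \<in> points (decomp_target m K B C E)"
    by (simp add: decomp_map_def)
  let ?X = "poly_space {1..m} K U V"
  \<comment> \<open>\<open>None\<close> indexes the fat wedge, where the map is constant;
    \<open>Some I\<close> indexes the part of the blocks in \<open>piece I\<close>.\<close>
  let ?T = "\<lambda>a. case a of None \<Rightarrow> source_base m B C | Some I \<Rightarrow> source_blocks \<inter> piece I"
  let ?f = "\<lambda>a. case a of None \<Rightarrow> (\<lambda>_. target_base m K B C E) | Some I \<Rightarrow> pinch m K B C E I"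
  let ?J = "insert None (Some ` Pow {1..m})"
  \<comment> \<open>Each local formula is a restriction of one global map, so agreement on overlaps
    is automatic.\<close>
  have eq: "decomp_map m K B C E (collapse_map (source_base m B C) u) = ?f a u"
    if a: "a \<in> ?J" and u: "u \<in> ?T a" for a u
  proof (cases a)
    case None
    then show ?thesis
      using u by (simp add: decomp_map_def collapse_lift_collapse_map)
  next
    case (Some I)
    then have I: "I \<subseteq> {1..m}" and u: "u \<in> source_blocks" "u \<in> piece I"
      using a u by auto
    have "pinch m K B C E I u =
        decomp_map m K B C E (collapse_map (source_base m B C) (glue m B C I
          (\<lambda>i\<in>I. wedge_snd (B i) (C i) (u i)) (\<lambda>j\<in>{1..m} - I. wedge_fst (B j) (C j) (u j))))"
      unfolding pinch_def using u
      by (intro decomp_map_glue[OF I, symmetric] wedge_fst_mem_b_box UnI2 wedge_snd_mem_c_blocks[OF I]) simp_all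
    then show ?thesis
      using Some glue_piece[OF u(2)] by simp
  qed
  show "continuous_map ?X (ptop (decomp_target m K B C E))
      (\<lambda>u. decomp_map m K B C E (collapse_map (source_base m B C) u))"
  proof (rule pasting_lemma_closed[where I = ?J and T = ?T and f = ?f])
    show "finite ?J" by simp
    fix a assume a: "a \<in> ?J"
    have D: "closedin source_product (source_base m B C \<union> source_blocks)"
      by (intro closedin_Un closedin_fat_wedge[OF closed_pairs_U] closedin_poly_blocks closed_pairs_U finite_complex)
    have "closedin source_product (?T a)"
      using closedin_fat_wedge[OF closed_pairs_U] closedin_piece
        closedin_poly_blocks[OF closed_pairs_U finite_complex(1)]
      by (cases a) auto
    moreover have "?T a \<subseteq> source_base m B C \<union> source_blocks"
      by (cases a) auto
    ultimately show "closedin ?X (?T a)"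
      unfolding poly_space_def closedin_closed_subtopology[OF D] by blast
    show "continuous_map (subtopology ?X (?T a)) (ptop (decomp_target m K B C E)) (?f a)"
    proof (cases a)
      case None
      then show ?thesis
        using WB by simp
    next
      case (Some I)
      then have I: "I \<subseteq> {1..m}"
        using a by auto
      have "subtopology ?X (?T a) = subtopology (subtopology source_product source_blocks) (?T a)"
        unfolding poly_space_def subtopology_subtopology using Some
        by (intro arg_cong[where f = "subtopology source_product"]) auto
      then show ?thesis
        using continuous_map_from_subtopology[OF continuous_map_pinch[OF I]] Some by simp
    qed
  next
    fix a a' u assume "a \<in> ?J" "a' \<in> ?J" "u \<in> topspace ?X \<inter> ?T a \<inter> ?T a'"
    then show "?f a u = ?f a' u"
      using eq[of a u] eq[of a' u] by simp
  next
    fix u assume "u \<in> topspace ?X"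
    then consider "u \<in> source_base m B C" | "u \<in> source_blocks"
      unfolding topspace_poly_space[OF closed_pairs_U] by blast
    then have "\<exists>a. a \<in> ?J \<and> u \<in> ?T a"
    proof cases
      case 1
      then show ?thesis
        by (intro exI[of _ None]) simp
    next
      case 2
      then show ?thesis
        using source_blocks_subset_pieces[OF 2]
        by (intro exI[of _ "Some (right_indices m B C u)"] conjI insertI2 imageI) (auto simp: right_indices_def)
    qed
    then obtain a where a: "a \<in> ?J" "u \<in> ?T a"
      by (elim exE conjE)
    then show "\<exists>a. a \<in> ?J \<and> u \<in> ?T a \<and>
        decomp_map m K B C E (collapse_map (source_base m B C) u) = ?f a u"
      using a eq[OF a] by (intro exI[of _ a] conjI)
  qed
qed

section \<open>Continuity of the inverse; the homotopy equivalence\<close>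

lemma continuous_map_glue:
  assumes I: "I \<subseteq> {1..m}"
  shows "continuous_map
    (kification (prod_topology (poly_space I (full_subcomplex K I) C E)
      (kification (product_topology (\<lambda>j. ptop (B j)) ({1..m} - I)))))
    (poly_space {1..m} K U V) (\<lambda>(c, b). glue m B C I c b)"
proof -
  let ?P = "poly_space I (full_subcomplex K I) C E"
  let ?Q = "kification (product_topology (\<lambda>j. ptop (B j)) ({1..m} - I))"
  let ?X = "kification (prod_topology ?P ?Q)"
  have c: "continuous_map ?X (ptop (C i)) (\<lambda>p. fst p i)" if "i \<in> I" for i
  proof -
    have "continuous_map ?P (ptop (C i)) (\<lambda>c. c i)"
      unfolding poly_space_def
      by (intro continuous_map_from_subtopology continuous_map_from_kification)
        (rule continuous_map_pointed_projection[OF that])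
    from continuous_map_compose[OF continuous_map_fst this] show ?thesis
      by (intro continuous_map_from_kification) (simp add: o_def)
  qed
  have b: "continuous_map ?X (ptop (B j)) (\<lambda>p. snd p j)" if "j \<in> {1..m} - I" for j
  proof -
    have "continuous_map ?Q (ptop (B j)) (\<lambda>b. b j)"
      by (intro continuous_map_from_kification) (rule continuous_map_pointed_projection[OF that])
    from continuous_map_compose[OF continuous_map_snd this] show ?thesis
      by (intro continuous_map_from_kification) (simp add: o_def)
  qed
  have "continuous_map ?X (ptop (U i)) (\<lambda>p. glue m B C I (fst p) (snd p) i)" if i: "i \<in> {1..m}" for i
  proof (cases "i \<in> I")
    case True
    then show ?thesis
      using continuous_map_compose[OF c[OF True] continuous_map_wedge_inr[of "C i" "B i"]] i
      by (simp add: glue_def o_def)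
  next
    case False
    then show ?thesis
      using continuous_map_compose[OF b[of i] continuous_map_wedge_inl[of "B i" "C i"]] i
      by (simp add: glue_def o_def)
  qed
  then have "continuous_map ?X (product_topology (\<lambda>i. ptop (U i)) {1..m}) (\<lambda>p. glue m B C I (fst p) (snd p))"
    unfolding continuous_map_componentwise by (auto simp: glue_def)
  moreover have "glue m B C I (fst p) (snd p) \<in> source_base m B C \<union> source_blocks" if "p \<in> topspace ?X" for p
    using that by (intro glue_mem_source[OF I]) (auto simp: topspace_poly_space[OF closed_pairs_C[OF I]])
  ultimately show ?thesis
    unfolding poly_space_def[of "{1..m}"] continuous_map_in_subtopology
      continuous_map_into_kification[OF k_space_kification] case_prod_unfold by blast
qed

text \<open>The collapse on the \<open>B\<close> side is treated first, next to the uncollapsed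
  \<open>C\<close> side, which is Hausdorff as a subspace of a kified product. The collapse on the
  \<open>C\<close> side then has the collapsed \<open>B\<close> side as its neighbour; that one is
  Hausdorff because it is the full smash product of the \<open>B\<^sub>j\<close>.\<close>

lemma continuous_map_factor_inverse:
  assumes I: "I \<subseteq> {1..m}"
  shows "continuous_map
    (kification (prod_topology (ptop (c_factor K C E I)) (ptop (b_factor m K B I))))
    (ptop (decomp_source m K B C E)) (factor_inverse m B C I)"
proof -
  let ?W = "ptop (decomp_source m K B C E)"
  let ?P = "poly_space I (full_subcomplex K I) C E"
  let ?Q = "kification (product_topology (\<lambda>j. ptop (B j)) ({1..m} - I))"
  have base: "source_base m B C \<in> topspace ?W"
    by (simp add: points_source)
  have "continuous_map (kification (prod_topology ?P ?Q)) ?W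
      (\<lambda>(c, b). collapse_map (source_base m B C) (glue m B C I c b))"
    using continuous_map_compose[OF continuous_map_glue[OF I] continuous_map_collapse_map[of _ "source_base m B C"]]
    by (simp add: source_eq o_def case_prod_unfold)
  then have glue: "continuous_map (kification (prod_topology ?P ?Q)) ?W
      (\<lambda>(c, b). factor_inverse m B C I (collapse_map (fat_wedge I C) c, collapse_map (fat_wedge ({1..m} - I) B) b))"
  proof (rule continuous_map_eq)
    fix p assume p: "p \<in> topspace (kification (prod_topology ?P ?Q))"
    obtain c b where cb: "p = (c, b)"
      by (cases p)
    then have "c \<in> fat_wedge I C \<union> c_blocks I" "b \<in> b_box I"
      using p by (auto simp: topspace_poly_space[OF closed_pairs_C[OF I]])
    from glue_mem_source_base_iff[OF I this]
    show "(case p of (c, b) \<Rightarrow> collapse_map (source_base m B C) (glue m B C I c b)) =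
        (case p of (c, b) \<Rightarrow> factor_inverse m B C I
          (collapse_map (fat_wedge I C) c, collapse_map (fat_wedge ({1..m} - I) B) b))"
      by (auto simp: cb factor_inverse_def collapse_lift_collapse_map collapse_map_def[of "source_base m B C"])
  qed
  have hP: "Hausdorff_space ?P"
    unfolding poly_space_def using C_facts(1) I
    by (intro Hausdorff_space_subtopology Hausdorff_space_kification)
      (auto simp: Hausdorff_space_product_topology)
  have kP: "k_space ?P"
    by (intro k_space_poly_space closed_pairs_C I finite_full_subcomplex)
  have hQ: "Hausdorff_space (ptop (b_factor m K B I))"
    unfolding b_factor_def polyhedral_smash_full[OF finite_full_subcomplex(2)]
    by (intro Hausdorff_space_big_smash) (auto intro: B_facts)
  have "continuous_map (kification (prod_topology ?P (ptop (b_factor m K B I)))) ?W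
      (\<lambda>(c, y). factor_inverse m B C I (collapse_map (fat_wedge I C) c, y))"
    unfolding b_factor_eq
  proof (rule continuous_map_kification_prod_collapse_right[OF k_space_kification hP])
    show "continuous_map ?P ?W (\<lambda>c. case (c, fat_wedge ({1..m} - I) B) of
        (c, y) \<Rightarrow> factor_inverse m B C I (collapse_map (fat_wedge I C) c, y))"
      using base by (simp add: factor_inverse_def collapse_lift_collapse_map cong: if_cong)
  qed (use glue in simp)
  then show ?thesis
    unfolding c_factor_eq[OF I]
    by (intro continuous_map_kification_prod_collapse_left kP hQ)
      (use base in \<open>simp_all add: factor_inverse_def\<close>)
qed

lemma continuous_map_decomp_inverse:
  "continuous_map (ptop (decomp_target m K B C E)) (ptop (decomp_source m K B C E)) (decomp_inverse m K B C E)"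
  unfolding decomp_target_def big_wedge_def decomp_inverse_def
proof (intro continuous_map_collapse_lift continuous_map_sum_topology)
  have base: "source_base m B C \<in> points (decomp_source m K B C E)"
    by (simp add: points_source)
  then show "source_base m B C \<in> points (decomp_source m K B C E)" .
  fix I assume "I \<in> Pow {1..m}"
  then have I: "I \<subseteq> {1..m}" by simp
  have "continuous_map (ptop (decomp_summand m K B C E I)) (ptop (decomp_source m K B C E))
      (collapse_lift (summand_base m K B C E I) (source_base m B C) (factor_inverse m B C I))"
    unfolding decomp_summand_eq smash_def
  proof (rule continuous_map_collapse_lift[OF continuous_map_factor_inverse[OF I] base])
    fix p assume "p \<in> summand_base m K B C E I"
    then show "factor_inverse m B C I p = source_base m B C"
      by (auto simp: smash_base_def pbase_c_factor[OF I] pbase_b_factor factor_inverse_def collapse_lift_const)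
  qed
  then show "continuous_map (ptop (decomp_summand m K B C E I)) (ptop (decomp_source m K B C E))
      (\<lambda>s. case (I, s) of (I, s) \<Rightarrow>
        collapse_lift (summand_base m K B C E I) (source_base m B C) (factor_inverse m B C I) s)"
    by simp
qed (auto simp: big_wedge_base_def pbase_summand)

lemma pointed_homotopy_equivalence_decomp_map:
  "pointed_homotopy_equivalence (decomp_source m K B C E) (decomp_target m K B C E) (decomp_map m K B C E)"
  unfolding pointed_homotopy_equivalence_def pointed_map_def pointed_homotopic_def
proof (intro conjI exI[of _ "decomp_inverse m K B C E"])
  let ?S = "decomp_source m K B C E" and ?T = "decomp_target m K B C E"
  let ?h = "decomp_map m K B C E" and ?g = "decomp_inverse m K B C E"
  show h: "continuous_map (ptop ?S) (ptop ?T) ?h" and g: "continuous_map (ptop ?T) (ptop ?S) ?g"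
    by (rule continuous_map_decomp_map continuous_map_decomp_inverse)+
  show hb: "?h (pbase ?S) = pbase ?T" and gb: "?g (pbase ?T) = pbase ?S"
    unfolding pbase_source pbase_target by (simp_all add: decomp_map_def decomp_inverse_def)
  \<comment> \<open>Both composites equal the identity on points, so equality already gives the
    homotopies.\<close>
  show "homotopic_with (\<lambda>k. k (pbase ?S) = pbase ?S) (ptop ?S) (ptop ?S) (?g \<circ> ?h) id"
    by (rule homotopic_with_equal)
      (simp_all add: hb gb continuous_map_compose[OF h g] decomp_inverse_decomp_map)
  show "homotopic_with (\<lambda>k. k (pbase ?T) = pbase ?T) (ptop ?T) (ptop ?T) (?h \<circ> ?g) id"
    by (rule homotopic_with_equal)
      (simp_all add: hb gb continuous_map_compose[OF g h] decomp_map_decomp_inverse)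
qed

end

section \<open>Naturality\<close>

text \<open>Away from both fat wedges the induced maps act on representatives. The images may still
  acquire coordinates at base points; the collapses built into \<open>target_point\<close> account
  for that.\<close>

lemma decomp_target_map_target_point:
  assumes "wedge_decomposition m K B C E" "wedge_decomposition m K B' C' E'"
    and I: "I \<subseteq> {1..m}"
    and c: "c \<notin> fat_wedge I C" and b: "b \<notin> fat_wedge ({1..m} - I) B"
  shows "decomp_target_map m K B C E B' C' E' f g (target_point m K B C E I c b) =
    target_point m K B' C' E' I (\<lambda>i\<in>I. g i (c i)) (\<lambda>j\<in>{1..m} - I. f j (b j))"
proof -
  interpret S: wedge_decomposition m K B C E by fact
  interpret T: wedge_decomposition m K B' C' E' by fact
  let ?x = "collapse_map (fat_wedge I C) c" and ?y = "collapse_map (fat_wedge ({1..m} - I) B) b"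
  have "?x \<noteq> fat_wedge I C" "?y \<noteq> fat_wedge ({1..m} - I) B"
    using c b by (auto simp: collapse_map_def)
  then have xy: "(?x, ?y) \<notin> summand_base m K B C E I"
    by (simp add: smash_base_def S.pbase_c_factor[OF I] S.pbase_b_factor)
  then have "summand_point m K B C E I c b \<noteq> summand_base m K B C E I"
    unfolding summand_point_def collapse_map_def by (metis singletonI)
  then have "(I, summand_point m K B C E I c b) \<notin> target_base m K B C E"
    by (simp add: S.pair_mem_target_base[OF I])
  then show ?thesis
    using xy c b
    by (simp add: decomp_target_map_def big_wedge_map_def smash_map_def big_smash_map_def
        collapse_induced_eq_lift collapse_lift_collapse_map target_point_def summand_point_def
        c_factor_def b_factor_def)
qed

lemma decomp_natural_decomp_map:
  assumes K: "simplicial_complex_on {1..m} K"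
  shows "decomp_natural m K (decomp_map m K) (decomp_map m K)"
  unfolding decomp_natural_def
proof (intro allI impI ballI, elim conjE)
  fix B :: "nat \<Rightarrow> 'a pointed" and C :: "nat \<Rightarrow> 'b pointed" and E
    and B' :: "nat \<Rightarrow> 'c pointed" and C' :: "nat \<Rightarrow> 'd pointed" and E' f g p
  assume dec: "wedge_decomposable m B C E" "wedge_decomposable m B' C' E'"
    and fg: "wedge_decomposable_map m B C E B' C' E' f g"
    and p: "p \<in> points (decomp_source m K B C E)"
  interpret S: wedge_decomposition m K B C E
    using K dec(1) by unfold_locales
  interpret T: wedge_decomposition m K B' C' E'
    using K dec(2) by unfold_locales
  have f: "f i (pbase (B i)) = pbase (B' i)" "x \<in> points (B i) \<Longrightarrow> f i x \<in> points (B' i)" 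
    and g: "g i (pbase (C i)) = pbase (C' i)" "y \<in> points (C i) \<Longrightarrow> g i y \<in> points (C' i)"
      "z \<in> E i \<Longrightarrow> g i z \<in> E' i"
    if "i \<in> {1..m}" for i x y z
    using bspec[OF fg[unfolded wedge_decomposable_map_def] that]
    by (auto simp: pointed_map_def continuous_map_def)
  show "decomp_map m K B' C' E' (decomp_source_map m B C B' C' f g p) =
      decomp_target_map m K B C E B' C' E' f g (decomp_map m K B C E p)"
    using p
  proof (cases rule: S.source_point_cases)
    case 1
    then show ?thesis
      by (simp add: decomp_map_def decomp_source_map_def big_smash_map_def decomp_target_map_def
          big_wedge_map_def collapse_induced_eq_lift)
  next
    case (2 I c b)
    let ?c = "\<lambda>i\<in>I. g i (c i)" and ?b = "\<lambda>j\<in>{1..m} - I. f j (b j)"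
    have "(\<lambda>i\<in>{1..m}. wedge_map (B i) (C i) (B' i) (C' i) (f i) (g i) (glue m B C I c b i)) =
        glue m B' C' I ?c ?b"
      by (rule extensionalityI[of _ "{1..m}"]) (auto simp: glue_def f(1) g(1))
    moreover have "glue m B C I c b \<notin> source_base m B C"
      using S.glue_mem_source_base_iff[of I c b] 2 by blast
    ultimately have src: "decomp_source_map m B C B' C' f g p =
        collapse_map (source_base m B' C') (glue m B' C' I ?c ?b)"
      by (simp add: 2 decomp_source_map_def big_smash_map_def collapse_induced_eq_lift collapse_lift_collapse_map)
    \<comment> \<open>The image tuple lies in the block of the same \<sigma>, because
      \<open>g i\<close> maps \<open>C i\<close> to \<open>C' i\<close> and \<open>E i\<close> into
      \<open>E' i\<close>.\<close>
    obtain \<sigma> where \<sigma>: "\<sigma> \<in> full_subcomplex K I" "c \<in> PiE I (\<lambda>i. if i \<in> \<sigma> then points (C i) else E i)"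
      using 2(2) by (auto simp: poly_blocks_def)
    have "g i (c i) \<in> (if i \<in> \<sigma> then points (C' i) else E' i)" if "i \<in> I" for i
    proof -
      have "i \<in> {1..m}"
        using that 2(1) by blast
      then show ?thesis
        using PiE_mem[OF \<sigma>(2) that] g by (auto split: if_splits)
    qed
    then have c: "?c \<in> T.c_blocks I"
      using \<sigma>(1) unfolding poly_blocks_def by (intro UN_I[of \<sigma>]) (auto simp: restrict_PiE_iff)
    have "f j (b j) \<in> points (B' j)" if "j \<in> {1..m} - I" for j
      using f(2)[of j "b j"] PiE_mem[OF 2(4) that] that by simp
    then have b: "?b \<in> T.b_box I"
      by (simp add: restrict_PiE_iff)
    have "decomp_map m K B' C' E' (decomp_source_map m B C B' C' f g p) = target_point m K B' C' E' I ?c ?b"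
      unfolding src by (rule T.decomp_map_glue[OF 2(1) UnI2[OF c] b])
    also have "\<dots> = decomp_target_map m K B C E B' C' E' f g (target_point m K B C E I c b)"
      by (rule decomp_target_map_target_point[symmetric])
        (use 2 S.wedge_decomposition_axioms T.wedge_decomposition_axioms in auto)
    also have "target_point m K B C E I c b = decomp_map m K B C E p"
      unfolding 2(6) by (rule S.decomp_map_glue[symmetric]) (use 2 in auto)
    finally show ?thesis .
  qed
qed

lemma decomp_equivalence_decomp_map:
  assumes "simplicial_complex_on {1..m} K"
  shows "decomp_equivalence m K (decomp_map m K)"
  unfolding decomp_equivalence_def
  by (intro allI impI wedge_decomposition.pointed_homotopy_equivalence_decomp_map
      wedge_decomposition.intro assms)

theorem theorem2p2:
  fixes m :: nat and K :: "nat set set"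
  assumes "simplicial_complex_on {1..m} K"
  shows "(\<exists>(h :: ('b, 'c) decomp_transformation) (h' :: ('b2, 'c2) decomp_transformation).
            decomp_equivalence m K h \<and> decomp_equivalence m K h' \<and>
            decomp_natural m K h h \<and> decomp_natural m K h h' \<and>
            decomp_natural m K h' h \<and> decomp_natural m K h' h') \<and>
         (\<forall>(B :: nat \<Rightarrow> 'b pointed) I.
            (\<forall>i\<in>{1..m}. pointed_CW_complex (B i)) \<and> I \<subseteq> {1..m} \<longrightarrow>
            polyhedral_smash ({1..m} - I) (full_subcomplex K ({1..m} - I)) B (\<lambda>j. points (B j)) =
            big_smash ({1..m} - I) B)"
proof (intro conjI exI allI impI)
  \<comment> \<open>One polymorphic map provides both witnesses: \<open>h\<close> and
    \<open>h'\<close> are its instances at the two pairs of point types, and all four naturality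
    claims are instances of one lemma.\<close>
  show "decomp_equivalence m K (decomp_map m K)" "decomp_equivalence m K (decomp_map m K)"
    by (rule decomp_equivalence_decomp_map[OF assms])+
  show "decomp_natural m K (decomp_map m K) (decomp_map m K)"
    "decomp_natural m K (decomp_map m K) (decomp_map m K)"
    "decomp_natural m K (decomp_map m K) (decomp_map m K)"
    "decomp_natural m K (decomp_map m K) (decomp_map m K)"
    by (rule decomp_natural_decomp_map[OF assms])+
next
  fix B :: "nat \<Rightarrow> 'b pointed" and I
  have "full_subcomplex K ({1..m} - I) \<noteq> {}"
    using assms by (auto simp: full_subcomplex_def simplicial_complex_on_def)
  then show "polyhedral_smash ({1..m} - I) (full_subcomplex K ({1..m} - I)) B (\<lambda>j. points (B j)) =
      big_smash ({1..m} - I) B"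
    by (rule polyhedral_smash_full)
qed

end
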